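(* Let $0\le\gamma<1$, let $\mathcal{H}$ be a complex Hilbert space, and fix $p\in[1,2]$. Let $f\in H^\infty(\Omega_\gamma,\mathcal{B}(\mathcal{H}))$ be given by $f(z)=\sum_{n=0}^\infty A_nz^n$ in $\mathbb{D}$ with $\|f\|_{H^\infty(\Omega_\gamma,\mathcal{B}(\mathcal{H}))}\le1$, where $A_0=\alpha_0I$ with $|\alpha_0|<1$ and $A_n\in\mathcal{B}(\mathcal{H})$ for all $n\ge0$. If $\phi=\{\phi_n(r)\}_{n=0}^\infty\in\mathcal{G}$ satisfies $$\phi_0(r)>\frac{2}{p(1+\gamma)}\sum_{n=1}^\infty\phi_n(r)\quad\text{for } r\in[0,R(p,\gamma)),$$ where $R(p,\gamma)$ is the smallest root in $(0,1)$ of the equation $\phi_0(x)=\frac{2}{p(1+\gamma)}\sum_{n=1}^\infty\phi_n(x)$, then $$\|A_0\|^p\phi_0(r)+\sum_{n=1}^\infty\|A_n\|\phi_n(r)\le\phi_0(r)\qquad( * )$$ holds for $|z|=r\le R(p,\gamma)$. Moreover, when $\phi_0(x)<\frac{2}{p(1+\gamma)}\sum_{n=1}^\infty\phi_n(x)$ in some interval $(R(p,\gamma),R(p,\gamma)+\epsilon)$ with $\epsilon>0$, the constant $R(p,\gamma)$ cannot be improved further (for every $R'\in(R(p,\gamma),1)$ there are a function $f\in H^\infty(\Omega_\gamma,\mathcal{B}(\mathcal{H}))$ with $\|f\|_{H^\infty(\Omega_\gamma,\mathcal{B}(\mathcal{H}))}\le1$ and $f(z)=\sum_{n=0}^\infty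 A_nz^n$ in $\mathbb{D}$, where $A_0=\alpha_0I$ with $|\alpha_0|<1$ and $A_n\in\mathcal{B}(\mathcal{H})$ for all $n\ge0$, and some $r\le R'$ for which $( * )$ fails). That is (when $\phi_0\le1$, so that $R_{p,1,\phi}$ is defined), $R_{p,1,\phi}(\Omega_\gamma,\mathcal{B}(\mathcal{H}))=R(p,\gamma)$.
   Context: $\mathbb{D}=\{z\in\mathbb{C}:|z|<1\}$ and, for $0\le\gamma<1$, $\Omega_\gamma=\{z\in\mathbb{C}:|z+\frac{\gamma}{1-\gamma}|<\frac1{1-\gamma}\}$, a disk containing $\mathbb{D}$. $\mathcal{B}(\mathcal{H})$ is the space of bounded linear operators on $\mathcal{H}$ with the operator norm, and $I$ is the identity operator. $H^\infty(\Omega,X)$ is the space of bounded analytic functions from $\Omega$ into a complex Banach space $X$, with $\|f\|_{H^\infty(\Omega,X)}=\sup_{z\in\Omega}\|f(z)\|$. $\mathcal{G}$ is the set of all sequences $\phi=\{\phi_n(r)\}_{n=0}^{\infty}$ of non-negative continuous functions on $[0,1)$ such that $\sum_{n=0}^{\infty}\phi_n(r)$ converges locally uniformly with respect to $r\in[0,1)$. For $f\in H^\infty(\Omega,X)$ with $f(z)=\sum_{n=0}^\infty x_nz^n$ in $\mathbb{D}$ and $\|f\|_{H^\infty(\Omega,X)}\le1$, for $\phi\in\mathcal{G}$ with $\phi_0(r)\le1$, and for $1\le p,q<\infty$, $$R_{p,q,\phi}(f,\Omega,X)=\sup\Big\{r\in[0,1):\ \|x_0\|^p\phi_0(r)+\Big(\sum_{n=1}^\infty\|x_n\|\phi_n(r)\Big)^q\le\phi_0(r)\Big\},$$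 and $R_{p,q,\phi}(\Omega,X)=\inf\{R_{p,q,\phi}(f,\Omega,X):\ \|f\|_{H^\infty(\Omega,X)}\le1\}$.
   Formalization: Sharpness needs H≠{0}. The final equality fails as written: its infimum is taken over f with A_0=α_0I, |α_0|<1, and its supremum over r such that ( * ) holds on all of [0,r] (or over all r if the admissible sets are initial segments of [0,1)). *)

theory Defs
  imports "HOL-Analysis.Analysis"
begin

class complex_normed_vector = real_normed_vector +
  fixes scaleC :: "complex \<Rightarrow> 'a \<Rightarrow> 'a" (infixr "*\<^sub>C" 75)
  assumes scaleC_add_right: "c *\<^sub>C (x + y) = c *\<^sub>C x + c *\<^sub>C y"
    and scaleC_add_left: "(c + d) *\<^sub>C x = c *\<^sub>C x + d *\<^sub>C x"
    and scaleC_scaleC: "c *\<^sub>C d *\<^sub>C x = (c * d) *\<^sub>C x"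
    and scaleC_of_real: "complex_of_real t *\<^sub>C x = t *\<^sub>R x"
    and norm_scaleC: "norm (c *\<^sub>C x) = cmod c * norm x"

text \<open>The inner product is linear in the first argument and induces the norm; positivity and
  definiteness are consequences of the last axiom.\<close>

class complex_inner = complex_normed_vector +
  fixes cinner :: "'a \<Rightarrow> 'a \<Rightarrow> complex"
  assumes cinner_commute: "cinner x y = cnj (cinner y x)"
    and cinner_add_left: "cinner (x + y) z = cinner x z + cinner y z"
    and cinner_scaleC_left: "cinner (c *\<^sub>C x) y = c * cinner x y"
    and cinner_self: "cinner x x = complex_of_real ((norm x)\<^sup>2)"

class complex_hilbert = complex_inner + banach

instantiation complex :: complex_hilbert
begin

definition scaleC_complex :: "complex \<Rightarrow> complex \<Rightarrow> complex"
  where "scaleC_complex c x = c * x"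

definition cinner_complex :: "complex \<Rightarrow> complex \<Rightarrow> complex"
  where "cinner_complex x y = x * cnj y"

instance
  by standard (auto simp: scaleC_complex_def cinner_complex_def algebra_simps norm_mult
      scaleR_conv_of_real complex_norm_square simp del: of_real_power)

end

text \<open>The library type of bounded linear maps consists of real-linear maps, hence the extra
  condition. The norm is the operator norm of that type.\<close>

typedef (overloaded) 'a bounded_op =
  "{T :: 'a::complex_normed_vector \<Rightarrow>\<^sub>L 'a. \<forall>c x. blinfun_apply T (c *\<^sub>C x) = c *\<^sub>C blinfun_apply T x}"
  morphisms blinfun_of_op Abs_bounded_op
  by (rule exI[of _ id_blinfun]) simp

setup_lifting type_definition_bounded_op

lemma bounded_linear_scaleC: "bounded_linear (\<lambda>x::'a::complex_normed_vector. c *\<^sub>C x)"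
proof (rule bounded_linear_intro[where K = "cmod c"])
  show "c *\<^sub>C (t *\<^sub>R x) = t *\<^sub>R c *\<^sub>C x" for t and x :: 'a
    by (simp flip: scaleC_of_real add: scaleC_scaleC mult.commute)
qed (simp_all add: scaleC_add_right norm_scaleC mult.commute)

lemma scaleC_zero_right [simp]: "c *\<^sub>C (0::'a::complex_normed_vector) = 0"
  by (rule bounded_linear.linear[OF bounded_linear_scaleC, THEN linear_0])

lemma scaleC_minus_right: "c *\<^sub>C (- x::'a::complex_normed_vector) = - (c *\<^sub>C x)"
  by (rule bounded_linear.linear[OF bounded_linear_scaleC, THEN linear_neg])

lemma scaleC_diff_right: "c *\<^sub>C (x - y::'a::complex_normed_vector) = c *\<^sub>C x - c *\<^sub>C y"
  by (rule bounded_linear.linear[OF bounded_linear_scaleC, THEN linear_diff])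

lemma scaleC_scaleR: "c *\<^sub>C t *\<^sub>R (x::'a::complex_normed_vector) = t *\<^sub>R c *\<^sub>C x"
  by (rule bounded_linear.linear[OF bounded_linear_scaleC, THEN linear_scale])

instantiation bounded_op :: (complex_normed_vector) real_normed_vector
begin

lift_definition zero_bounded_op :: "'a bounded_op" is 0
  by simp
lift_definition plus_bounded_op :: "'a bounded_op \<Rightarrow> 'a bounded_op \<Rightarrow> 'a bounded_op" is "(+)"
  by (simp add: blinfun.add_left scaleC_add_right)
lift_definition uminus_bounded_op :: "'a bounded_op \<Rightarrow> 'a bounded_op" is uminus
  by (simp add: blinfun.minus_left scaleC_minus_right)
lift_definition minus_bounded_op :: "'a bounded_op \<Rightarrow> 'a bounded_op \<Rightarrow> 'a bounded_op" is "(-)"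
  by (simp add: blinfun.diff_left scaleC_diff_right)
lift_definition scaleR_bounded_op :: "real \<Rightarrow> 'a bounded_op \<Rightarrow> 'a bounded_op" is "(*\<^sub>R)"
  by (simp add: blinfun.scaleR_left scaleC_scaleR)
lift_definition norm_bounded_op :: "'a bounded_op \<Rightarrow> real" is norm .

definition dist_bounded_op :: "'a bounded_op \<Rightarrow> 'a bounded_op \<Rightarrow> real"
  where "dist_bounded_op S T = norm (S - T)"
definition sgn_bounded_op :: "'a bounded_op \<Rightarrow> 'a bounded_op"
  where "sgn_bounded_op T = scaleR (inverse (norm T)) T"
definition [code del]:
  "(uniformity :: ('a bounded_op \<times> 'a bounded_op) filter) =
     (INF e\<in>{0 <..}. principal {(S, T). dist S T < e})"
definition open_bounded_op :: "'a bounded_op set \<Rightarrow> bool"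
  where [code del]: "open_bounded_op U =
    (\<forall>S\<in>U. \<forall>\<^sub>F (S', T) in uniformity. S' = S \<longrightarrow> T \<in> U)"

instance
proof
  fix S T U :: "'a bounded_op" and s t :: real
  show "S + T + U = S + (T + U)" "S + T = T + S" "0 + S = S" "- S + S = 0" "S - T = S + - T"
    by (transfer; simp)+
  show "s *\<^sub>R (S + T) = s *\<^sub>R S + s *\<^sub>R T" "(s + t) *\<^sub>R S = s *\<^sub>R S + t *\<^sub>R S"
    "s *\<^sub>R t *\<^sub>R S = (s * t) *\<^sub>R S" "1 *\<^sub>R S = S"
    by (transfer; simp add: algebra_simps)+
  show "norm S = 0 \<longleftrightarrow> S = 0" "norm (s *\<^sub>R S) = \<bar>s\<bar> * norm S"
    by (transfer; simp)+
  show "norm (S + T) \<le> norm S + norm T"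
    by (transfer; rule norm_triangle_ineq)
qed (simp_all add: dist_bounded_op_def sgn_bounded_op_def uniformity_bounded_op_def
      open_bounded_op_def)

end

instantiation bounded_op :: (complex_normed_vector) complex_normed_vector
begin

lift_definition scaleC_bounded_op :: "complex \<Rightarrow> 'a bounded_op \<Rightarrow> 'a bounded_op"
  is "\<lambda>c T. blinfun_compose (Blinfun ((*\<^sub>C) c)) T"
  by (simp add: bounded_linear_Blinfun_apply bounded_linear_scaleC scaleC_scaleC mult.commute)

instance
proof
  fix S T :: "'a bounded_op" and c d :: complex and t :: real
  note app = blinfun.add_left blinfun.scaleR_left
    bounded_linear_Blinfun_apply bounded_linear_scaleC
  show "c *\<^sub>C (S + T) = c *\<^sub>C S + c *\<^sub>C T" "(c + d) *\<^sub>C S = c *\<^sub>C S + d *\<^sub>C S"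
    "c *\<^sub>C d *\<^sub>C S = (c * d) *\<^sub>C S" "complex_of_real t *\<^sub>C S = t *\<^sub>R S"
    by (transfer; intro blinfun_eqI;
        simp add: app scaleC_add_left scaleC_add_right scaleC_scaleC scaleC_of_real)+
  show "norm (c *\<^sub>C S) = cmod c * norm S"
  proof (transfer fixing: c)
    fix S :: "'a \<Rightarrow>\<^sub>L 'a"
    have le: "norm (Blinfun ((*\<^sub>C) c) o\<^sub>L T) \<le> cmod c * norm T" for c and T :: "'a \<Rightarrow>\<^sub>L 'a"
    proof (rule norm_blinfun_bound)
      show "norm ((Blinfun ((*\<^sub>C) c) o\<^sub>L T) x) \<le> cmod c * norm T * norm x" for x
        using norm_blinfun[of T x]
        by (simp add: app norm_scaleC mult.assoc mult_left_mono)
    qed simp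
    show "norm (Blinfun ((*\<^sub>C) c) o\<^sub>L S) = cmod c * norm S"
    proof (cases "c = 0")
      case True
      with le[of c S] show ?thesis by simp
    next
      case False
      have "Blinfun ((*\<^sub>C) (inverse c)) o\<^sub>L (Blinfun ((*\<^sub>C) c) o\<^sub>L S) = S"
        using False scaleC_of_real[of 1]
        by (intro blinfun_eqI) (simp add: app scaleC_scaleC)
      with le[of "inverse c" "Blinfun ((*\<^sub>C) c) o\<^sub>L S"]
      have "norm S \<le> inverse (cmod c) * norm (Blinfun ((*\<^sub>C) c) o\<^sub>L S)"
        by (simp add: norm_inverse)
      then have "cmod c * norm S \<le> norm (Blinfun ((*\<^sub>C) c) o\<^sub>L S)"
        using False by (simp add: field_simps)
      with le[of c S] show ?thesis by simp
    qed
  qed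
qed

end

instance bounded_op :: (complex_hilbert) banach
proof
  fix X :: "nat \<Rightarrow> 'a bounded_op"
  assume "Cauchy X"
  have dist_eq: "dist S T = dist (blinfun_of_op S) (blinfun_of_op T)" for S T :: "'a bounded_op"
    by (simp add: dist_norm norm_bounded_op.rep_eq minus_bounded_op.rep_eq)
  from \<open>Cauchy X\<close> have "Cauchy (\<lambda>n. blinfun_of_op (X n))"
    by (simp add: Cauchy_def dist_eq)
  then obtain T where T: "(\<lambda>n. blinfun_of_op (X n)) \<longlonglongrightarrow> T"
    by (auto simp: Cauchy_convergent_iff convergent_def)
  have "T (c *\<^sub>C x) = c *\<^sub>C T x" for c x
  proof (rule LIMSEQ_unique)
    show "(\<lambda>n. blinfun_of_op (X n) (c *\<^sub>C x)) \<longlonglongrightarrow> T (c *\<^sub>C x)"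
      by (intro blinfun.tendsto T tendsto_const)
    have "(\<lambda>n. c *\<^sub>C blinfun_of_op (X n) x) \<longlonglongrightarrow> c *\<^sub>C T x"
      by (intro bounded_linear.tendsto[OF bounded_linear_scaleC] blinfun.tendsto T tendsto_const)
    moreover have "blinfun_of_op (X n) (c *\<^sub>C x) = c *\<^sub>C blinfun_of_op (X n) x" for n
      using blinfun_of_op[of "X n"] by simp
    ultimately show "(\<lambda>n. blinfun_of_op (X n) (c *\<^sub>C x)) \<longlonglongrightarrow> c *\<^sub>C T x" by simp
  qed
  then have "blinfun_of_op (Abs_bounded_op T) = T"
    by (simp add: Abs_bounded_op_inverse)
  with T have "X \<longlonglongrightarrow> Abs_bounded_op T"
    by (simp add: tendsto_iff dist_eq)
  then show "convergent X" by (auto simp: convergent_def)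
qed

lift_definition id_op :: "'a::complex_normed_vector bounded_op" is id_blinfun
  by simp

text \<open>The library's \<open>holomorphic_on\<close> only covers functions with values in a field.\<close>

definition analytic_fun :: "complex set \<Rightarrow> (complex \<Rightarrow> 'x::{complex_normed_vector,banach}) \<Rightarrow> bool"
  where "analytic_fun \<Omega> f \<longleftrightarrow>
    (\<forall>z\<in>\<Omega>. \<exists>D. (f has_derivative (\<lambda>h. h *\<^sub>C D)) (at z within \<Omega>))"

definition H_inf :: "complex set \<Rightarrow> (complex \<Rightarrow> 'x::{complex_normed_vector,banach}) set"
  where "H_inf \<Omega> = {f. analytic_fun \<Omega> f \<and> bounded (f ` \<Omega>)}"

definition H_inf_norm :: "complex set \<Rightarrow> (complex \<Rightarrow> 'x::{complex_normed_vector,banach}) \<Rightarrow> real"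
  where "H_inf_norm \<Omega> f = (SUP z\<in>\<Omega>. norm (f z))"

definition has_expansion ::
    "(complex \<Rightarrow> 'x::{complex_normed_vector,banach}) \<Rightarrow> (nat \<Rightarrow> 'x) \<Rightarrow> bool"
  where "has_expansion f x \<longleftrightarrow> (\<forall>z\<in>ball 0 1. (\<lambda>n. z ^ n *\<^sub>C x n) sums f z)"

definition taylor_coeff :: "(complex \<Rightarrow> 'x::{complex_normed_vector,banach}) \<Rightarrow> nat \<Rightarrow> 'x"
  where "taylor_coeff f = (THE x. has_expansion f x)"

definition Omega_disk :: "real \<Rightarrow> complex set"
  where "Omega_disk \<gamma> = {z. cmod (z + complex_of_real (\<gamma> / (1 - \<gamma>))) < 1 / (1 - \<gamma>)}"

definition weights :: "(nat \<Rightarrow> real \<Rightarrow> real) set"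
  where "weights = {\<phi>.
    (\<forall>n. continuous_on {0..<1} (\<phi> n) \<and> (\<forall>r\<in>{0..<1}. 0 \<le> \<phi> n r)) \<and>
    (\<forall>r\<in>{0..<1}. \<exists>d>0.
      uniformly_convergent_on (ball r d \<inter> {0..<1}) (\<lambda>N s. \<Sum>n<N. \<phi> n s))}"

definition bohr_set ::
    "real \<Rightarrow> real \<Rightarrow> (nat \<Rightarrow> real \<Rightarrow> real) \<Rightarrow> (complex \<Rightarrow> 'x::{complex_normed_vector,banach}) \<Rightarrow> real set"
  where "bohr_set p q \<phi> f = {r\<in>{0..<1}.
    norm (taylor_coeff f 0) powr p * \<phi> 0 r
      + (\<Sum>n. norm (taylor_coeff f (Suc n)) * \<phi> (Suc n) r) powr q \<le> \<phi> 0 r}"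

text \<open>The infimum is taken over an arbitrary family \<open>F\<close> of functions; for
  \<open>F = {f \<in> H_inf \<Omega>. H_inf_norm \<Omega> f \<le> 1}\<close> this is the radius of the whole unit ball
  of \<open>H_inf \<Omega>\<close>.\<close>

definition bohr_radius ::
    "real \<Rightarrow> real \<Rightarrow> (nat \<Rightarrow> real \<Rightarrow> real) \<Rightarrow> (complex \<Rightarrow> 'x::{complex_normed_vector,banach}) set \<Rightarrow> real"
  where "bohr_radius p q \<phi> F = (INF f\<in>F. Sup (bohr_set p q \<phi> f))"

text \<open>The admissible set \<open>bohr_set p q \<phi> f\<close> need not be an interval for general weights: it may
  contain points far beyond the first radius at which the inequality fails. The following variant
  takes, for each \<open>f\<close>, the supremum of the radii up to which the inequality holds without
  exception; the two coincide when all the sets are initial segments of \<open>{0..<1}\<close>.\<close>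

definition initial_bohr_radius ::
    "real \<Rightarrow> real \<Rightarrow> (nat \<Rightarrow> real \<Rightarrow> real) \<Rightarrow> (complex \<Rightarrow> 'x::{complex_normed_vector,banach}) set \<Rightarrow> real"
  where "initial_bohr_radius p q \<phi> F =
    (INF f\<in>F. Sup {r\<in>{0..<1}. {0..r} \<subseteq> bohr_set p q \<phi> f})"

text \<open>Over the whole unit ball of \<open>H_inf \<Omega>\<close> the infimum degenerates as soon as the Hilbert
  space has dimension at least two: on the unit disk, \<open>f(z) = diag(1, z)\<close> has coefficients of
  norm 1 at \<open>0\<close> and \<open>1\<close>, so the inequality fails wherever \<open>\<phi> 1 r > 0\<close>. Hence the restriction to
  constant coefficients \<open>\<alpha>I\<close> with \<open>|\<alpha>| < 1\<close>.\<close>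

definition scalar_start_ball :: "complex set \<Rightarrow> (complex \<Rightarrow> 'h::complex_hilbert bounded_op) set"
  where "scalar_start_ball \<Omega> = {f \<in> H_inf \<Omega>. H_inf_norm \<Omega> f \<le> 1 \<and>
    (\<exists>A \<alpha>. has_expansion f A \<and> A 0 = \<alpha> *\<^sub>C id_op \<and> cmod \<alpha> < 1)}"

end

theory Submission
  imports Defs "HOL-Complex_Analysis.Complex_Analysis"
begin

text \<open>
  Everything rests on one coefficient estimate. If \<open>f\<close> maps \<open>Omega_disk \<gamma>\<close> into the contractions
  and \<open>f(z) = \<Sum> z\<^sup>n A\<^sub>n\<close> with \<open>A\<^sub>0 = \<alpha> I\<close>, then \<open>\<parallel>A\<^sub>n\<parallel> \<le> (1 - |\<alpha>|\<^sup>2) / (1 + \<gamma>)\<close> for all \<open>n \<ge> 1\<close>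
  (\<open>scalar_start_coeff_bound_Omega\<close>). Given this, the left-hand side of the Bohr inequality is at
  most \<open>|\<alpha>|\<^sup>p \<phi>\<^sub>0 + (1 - |\<alpha>|\<^sup>2) / (1 + \<gamma>) \<Sum> \<phi>\<^sub>n\<close>; up to the radius \<open>R\<close> the sum is at most
  \<open>p (1 + \<gamma>) / 2 \<phi>\<^sub>0\<close>, and the concavity of \<open>t \<mapsto> t\<^bsup>p/2\<^esup>\<close>, in the form
  \<open>p/2 (1 - |\<alpha>|\<^sup>2) \<le> 1 - |\<alpha>|\<^sup>p\<close>, closes the estimate. This is where \<open>p \<le> 2\<close> enters.

  The coefficient estimate is proved in two steps. On the unit disk (\<open>scalar_start_coeff_bound\<close>)
  a contraction-valued \<open>S(w) = \<alpha> I + \<Sum>\<^sub>k w\<^sup>k C\<^sub>k\<close> is paired, for unit vectors \<open>x\<close>, \<open>y\<close> and \<open>|z| = 1\<close>,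
  with the vectors \<open>x + z\<mu> y\<close> and \<open>cnj \<mu> x + z y\<close>. With \<open>z\<close> the \<open>k\<close>-th power of the variable on
  the circle, the mean of the pairing is \<open>2\<alpha>\<mu> + \<langle>C\<^sub>k x, y\<rangle>\<close>, while Cauchy--Schwarz and the common
  expansion of both squared norms bound that mean by \<open>1 + |\<mu>|\<^sup>2\<close>. Taking \<open>|\<mu>| = |\<alpha>|\<close>, with the argument
  that aligns both terms, leaves \<open>|\<langle>C\<^sub>k x, y\<rangle>| \<le> 1 - |\<alpha>|\<^sup>2\<close>. Pairing with two different vectors is
  essential: applying the scalar estimate to \<open>\<langle>S(w) x, y\<rangle>\<close> alone would only give
  \<open>1 - |\<alpha>|\<^sup>2 |\<langle>x, y\<rangle>|\<^sup>2\<close>.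

  For the second step, \<open>f(z) = S(u(z))\<close> with \<open>u(z) = z / (1 + \<gamma> - \<gamma> z)\<close>, a conformal map of
  \<open>Omega_disk \<gamma>\<close> onto the unit disk that fixes \<open>0\<close> and has non-negative Taylor coefficients. So
  \<open>A\<^sub>n\<close> is a combination of the \<open>C\<^sub>k\<close>, \<open>1 \<le> k \<le> n\<close>, whose weights are the coefficients of
  \<open>u\<^sup>k\<close> at \<open>z\<^sup>n\<close>; they are non-negative and add up to the coefficient of
  \<open>\<Sum>\<^sub>k u\<^sup>k = u / (1 - u) = z / ((1 + \<gamma>)(1 - z))\<close>, which is \<open>1 / (1 + \<gamma>)\<close>.

  For sharpness, the multiples of \<open>I\<close> by \<open>z \<mapsto> (a - u(z)) / (1 - a u(z))\<close>, \<open>a < 1\<close>, nearly attain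
  the coefficient estimate for all \<open>n\<close> simultaneously as \<open>a\<close> tends to \<open>1\<close>. At any radius where
  \<open>\<phi>\<^sub>0 < 2 / (p (1 + \<gamma>)) \<Sum> \<phi>\<^sub>n\<close> one of them violates the inequality
  (\<open>extremal_coeff_violation\<close>). If such radii fill an interval to the right of \<open>R\<close>, no radius
  beyond \<open>R\<close> is admissible for all \<open>f\<close>, and both statements about Bohr radii follow.
\<close>

section \<open>Inner products and matrix coefficients of operators\<close>

lemma cinner_add_right: "cinner x (y + z) = cinner x y + cinner (x::'a::complex_inner) z"
  by (simp add: cinner_commute[of x] cinner_add_left)

lemma cinner_scaleC_right: "cinner x (c *\<^sub>C y) = cnj c * cinner (x::'a::complex_inner) y"
  by (simp add: cinner_commute[of x] cinner_scaleC_left)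

lemma cinner_zero_right [simp]: "cinner (x::'a::complex_inner) 0 = 0"
  using cinner_add_right[of x 0 0] by simp

lemma cinner_scaleR_left: "cinner (t *\<^sub>R x) y = t *\<^sub>R cinner (x::'a::complex_inner) y"
  by (simp add: cinner_scaleC_left scaleR_conv_of_real flip: scaleC_of_real)

lemma norm_add_sq:
  "(norm (x + y))\<^sup>2 = (norm x)\<^sup>2 + (norm (y::'a::complex_inner))\<^sup>2 + 2 * Re (cinner x y)"
proof -
  have "complex_of_real ((norm (x + y))\<^sup>2) = cinner x x + cinner y y + (cinner x y + cnj (cinner x y))"
    by (simp only: cinner_self[symmetric])
      (simp add: cinner_add_left cinner_add_right cinner_commute[of y x])
  also have "\<dots> = complex_of_real ((norm x)\<^sup>2 + (norm y)\<^sup>2 + 2 * Re (cinner x y))"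
    by (simp only: cinner_self complex_add_cnj of_real_add)
  finally show ?thesis
    using of_real_eq_iff by blast
qed

lemma Cauchy_Schwarz_cinner: "cmod (cinner x y) \<le> norm x * norm (y::'a::complex_inner)"
proof (cases "y = 0")
  case False
  \<comment> \<open>the coefficient for which \<open>x + c y\<close> is orthogonal to \<open>y\<close>\<close>
  define c where "c = - (cinner x y / complex_of_real ((norm y)\<^sup>2))"
  have "0 \<le> (norm (x + c *\<^sub>C y))\<^sup>2" by simp
  also have "\<dots> = (norm x)\<^sup>2 + (cmod c)\<^sup>2 * (norm y)\<^sup>2 + 2 * Re (cnj c * cinner x y)"
    by (simp add: norm_add_sq cinner_scaleC_right norm_scaleC power_mult_distrib)
  also have "cnj c * cinner x y = complex_of_real (- ((cmod (cinner x y))\<^sup>2 / (norm y)\<^sup>2))"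
    by (simp add: c_def complex_norm_square mult.commute del: of_real_power)
  also have "(cmod c)\<^sup>2 * (norm y)\<^sup>2 = (cmod (cinner x y))\<^sup>2 / (norm y)\<^sup>2"
    using False by (simp add: c_def norm_divide power_divide power2_eq_square norm_mult field_simps)
  finally have "(cmod (cinner x y))\<^sup>2 / (norm y)\<^sup>2 \<le> (norm x)\<^sup>2"
    by simp
  then have "(cmod (cinner x y))\<^sup>2 \<le> (norm x * norm y)\<^sup>2"
    using False by (simp add: pos_divide_le_eq power_mult_distrib)
  then show ?thesis
    by (rule power2_le_imp_le) simp
qed simp

lemma scaleC_one [simp]: "1 *\<^sub>C (x::'a::complex_normed_vector) = x"
  using scaleC_of_real[of 1 x] by simp

lemma scaleC_zero_left [simp]: "0 *\<^sub>C (x::'a::complex_normed_vector) = 0"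
  using scaleC_of_real[of 0 x] by simp

lemma op_apply_norm_le: "norm (blinfun_of_op T x) \<le> norm T * norm x"
  by (simp add: norm_bounded_op.rep_eq norm_blinfun)

lemma op_apply_scaleC: "blinfun_of_op T (c *\<^sub>C x) = c *\<^sub>C blinfun_of_op T x"
  using blinfun_of_op[of T] by simp

lemma blinfun_of_op_scaleC: "blinfun_of_op (c *\<^sub>C T) x = c *\<^sub>C blinfun_of_op T x"
  by (simp add: scaleC_bounded_op.rep_eq bounded_linear_Blinfun_apply bounded_linear_scaleC)

lemma norm_id_op_le: "norm (id_op :: 'h::complex_normed_vector bounded_op) \<le> 1"
  by (simp add: norm_bounded_op.rep_eq id_op.rep_eq norm_blinfun_id_le)

lemma norm_id_op:
  assumes "(x::'h::complex_normed_vector) \<noteq> 0"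
  shows "norm (id_op :: 'h bounded_op) = 1"
proof (rule antisym[OF norm_id_op_le])
  have "norm x \<le> norm (id_op :: 'h bounded_op) * norm x"
    using norm_blinfun[of "blinfun_of_op (id_op :: 'h bounded_op)" x]
    by (simp add: id_op.rep_eq norm_bounded_op.rep_eq)
  then show "1 \<le> norm (id_op :: 'h bounded_op)"
    using assms by simp
qed

text \<open>Matrix coefficients are bounded complex-linear functionals that determine the operator and its
  norm. They reduce holomorphy and power series with operator values to the complex-valued case.\<close>
definition matrix_coeff :: "'h::complex_inner \<Rightarrow> 'h \<Rightarrow> 'h bounded_op \<Rightarrow> complex"
  where "matrix_coeff x y T = cinner (blinfun_of_op T x) y"

lemma matrix_coeff_scaleC: "matrix_coeff x y (c *\<^sub>C T) = c * matrix_coeff x y T"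
  by (simp add: matrix_coeff_def blinfun_of_op_scaleC cinner_scaleC_left)

lemma matrix_coeff_norm_le: "cmod (matrix_coeff x y T) \<le> norm T * norm x * norm y"
  unfolding matrix_coeff_def
  by (rule order_trans[OF Cauchy_Schwarz_cinner]) (simp add: op_apply_norm_le mult_right_mono)

lemma bounded_linear_matrix_coeff: "bounded_linear (matrix_coeff x y)"
proof (rule bounded_linear_intro[where K = "norm x * norm y"])
  show "cmod (matrix_coeff x y T) \<le> norm T * (norm x * norm y)" for T
    using matrix_coeff_norm_le[of x y T] by (simp add: mult.assoc)
qed (simp_all add: matrix_coeff_def plus_bounded_op.rep_eq scaleR_bounded_op.rep_eq
    blinfun.add_left blinfun.scaleR_left cinner_add_left cinner_scaleR_left)

lemma op_norm_le_matrix_coeff: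
  fixes T :: "'h::complex_hilbert bounded_op"
  assumes "0 \<le> M" and le: "\<And>x y. norm x = 1 \<Longrightarrow> norm y = 1 \<Longrightarrow> cmod (matrix_coeff x y T) \<le> M"
  shows "norm T \<le> M"
  unfolding norm_bounded_op.rep_eq
proof (rule norm_blinfun_bound)
  fix x :: 'h
  \<comment> \<open>The choice of \<open>y\<close> in the direction of \<open>T x\<close> turns the matrix coefficient into \<open>\<parallel>T x\<parallel>\<close>.\<close>
  define y where "y = blinfun_of_op T x"
  show "norm (blinfun_of_op T x) \<le> M * norm x"
  proof (cases "x = 0 \<or> y = 0")
    case True
    then show ?thesis using \<open>0 \<le> M\<close> by (auto simp: y_def)
  next
    case False
    define s t where "s = complex_of_real (inverse (norm x))" and "t = complex_of_real (inverse (norm y))"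
    have 1: "norm (s *\<^sub>C x) = 1" "norm (t *\<^sub>C y) = 1"
      using False by (simp_all add: s_def t_def norm_scaleC norm_inverse)
    have "matrix_coeff (s *\<^sub>C x) (t *\<^sub>C y) T = s * cnj t * cinner y y"
      by (simp add: matrix_coeff_def op_apply_scaleC cinner_scaleC_left cinner_scaleC_right y_def)
    also have "\<dots> = complex_of_real (norm y / norm x)"
      using False by (simp add: s_def t_def cinner_self power2_eq_square field_simps)
    finally have "norm y / norm x \<le> M"
      using le[OF 1] by (simp only: norm_of_real abs_of_nonneg divide_nonneg_nonneg norm_ge_zero)
    then show ?thesis
      using False by (simp add: y_def field_simps)
  qed
qed fact

section \<open>Analytic functions with operator values\<close>

lemma matrix_coeff_holomorphic:
  assumes "analytic_fun \<Omega> f"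
  shows "(\<lambda>z. matrix_coeff x y (f z)) holomorphic_on \<Omega>"
  unfolding holomorphic_on_def field_differentiable_def
proof
  fix z assume "z \<in> \<Omega>"
  then obtain D where "(f has_derivative (\<lambda>h. h *\<^sub>C D)) (at z within \<Omega>)"
    using assms by (auto simp: analytic_fun_def)
  from bounded_linear.has_derivative[OF bounded_linear_matrix_coeff this]
  have "((\<lambda>z. matrix_coeff x y (f z)) has_derivative (\<lambda>h. matrix_coeff x y D * h)) (at z within \<Omega>)"
    by (simp add: matrix_coeff_scaleC mult.commute)
  then show "\<exists>D'. ((\<lambda>z. matrix_coeff x y (f z)) has_field_derivative D') (at z within \<Omega>)"
    by (auto simp: has_field_derivative_def)
qed

lemma has_fps_expansion_matrix_coeff:
  assumes "has_expansion f A"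
  shows "(\<lambda>z. matrix_coeff x y (f z)) has_fps_expansion Abs_fps (\<lambda>n. matrix_coeff x y (A n))"
proof (rule has_fps_expansionI)
  have "(\<lambda>n. matrix_coeff x y (A n) * z ^ n) sums matrix_coeff x y (f z)" if "z \<in> ball 0 1" for z
  proof -
    have "(\<lambda>n. z ^ n *\<^sub>C A n) sums f z"
      using assms that by (simp add: has_expansion_def)
    from bounded_linear.sums[OF bounded_linear_matrix_coeff this] show ?thesis
      by (simp add: matrix_coeff_scaleC mult.commute)
  qed
  then show "\<forall>\<^sub>F u in nhds 0. (\<lambda>n. fps_nth (Abs_fps (\<lambda>n. matrix_coeff x y (A n))) n * u ^ n)
      sums matrix_coeff x y (f u)"
    using eventually_nhds_in_open[of "ball 0 1" "0::complex"] by (auto elim!: eventually_mono)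
qed

lemma has_expansion_unique:
  fixes A B :: "nat \<Rightarrow> 'h::complex_hilbert bounded_op"
  assumes "has_expansion f A" "has_expansion f B"
  shows "A = B"
proof
  fix n
  have "matrix_coeff x y (A n) = matrix_coeff x y (B n)" for x y
    using fps_expansion_unique_complex[OF assms[THEN has_fps_expansion_matrix_coeff, of x y]]
    by (metis fps_nth_Abs_fps)
  then have "norm (A n - B n) \<le> 0"
    by (intro op_norm_le_matrix_coeff)
       (simp_all add: bounded_linear.linear[OF bounded_linear_matrix_coeff, THEN linear_diff])
  then show "A n = B n" by simp
qed

lemma taylor_coeff_eq:
  fixes A :: "nat \<Rightarrow> 'h::complex_hilbert bounded_op"
  shows "has_expansion f A \<Longrightarrow> taylor_coeff f = A"
  unfolding taylor_coeff_def by (blast intro: the_equality has_expansion_unique)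

lemma has_expansion_at_0:
  assumes "has_expansion f A"
  shows "f 0 = A 0"
proof -
  have "(\<lambda>n. 0 ^ n *\<^sub>C A n) sums f 0"
    using assms by (simp add: has_expansion_def)
  moreover have "(\<lambda>n. 0 ^ n *\<^sub>C A n) = (\<lambda>n. if n = 0 then A n else 0)"
    by (auto simp: power_0_left)
  ultimately show ?thesis
    using sums_single[of 0 A] sums_unique2 by metis
qed

lemma norm_le_H_inf_norm:
  assumes "f \<in> H_inf \<Omega>" "z \<in> \<Omega>"
  shows "norm (f z) \<le> H_inf_norm \<Omega> f"
  unfolding H_inf_norm_def
  using assms by (intro cSUP_upper bounded_imp_bdd_above) (auto simp: H_inf_def bounded_norm_comp)

section \<open>Taylor coefficients on the unit disk\<close>

text \<open>The two vectors \<open>x + z\<mu> y\<close> and \<open>cnj \<mu> x + z y\<close> are chosen so that their norms have the same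
  expansion, whose cross term is a multiple of \<open>cnj z\<close> and hence disappears when \<open>z\<close> is averaged
  over the unit circle. The same averaging isolates the \<open>k\<close>-th Taylor coefficient in the term with
  \<open>cnj z\<close> on the left and removes the term with \<open>z\<close>.\<close>
lemma contraction_pairing_le:
  fixes T :: "'h::complex_hilbert bounded_op" and \<mu> z :: complex
  assumes T: "norm T \<le> 1" and x: "norm x = 1" and y: "norm y = 1" and z: "cmod z = 1"
  shows "cmod (\<mu> * matrix_coeff x x T + \<mu> * matrix_coeff y y T
      + cnj z * matrix_coeff x y T + z * \<mu>\<^sup>2 * matrix_coeff y x T)
    \<le> 1 + (cmod \<mu>)\<^sup>2 + 2 * Re (cnj z * cnj \<mu> * cinner x y)" (is "cmod ?L \<le> ?R")
proof -
  define u v where "u = x + (z * \<mu>) *\<^sub>C y" and "v = cnj \<mu> *\<^sub>C x + z *\<^sub>C y"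
  have zz: "z * cnj z = 1"
    using z by (simp add: complex_norm_square[symmetric])
  have "matrix_coeff u v T = ?L + (z * cnj z - 1) * \<mu> * matrix_coeff y y T"
    by (simp add: u_def v_def matrix_coeff_def blinfun.add_right op_apply_scaleC cinner_add_left
        cinner_add_right cinner_scaleC_left cinner_scaleC_right algebra_simps power2_eq_square)
  then have "cmod ?L \<le> norm T * norm u * norm v"
    using matrix_coeff_norm_le[of u v T] zz by simp
  also have "\<dots> \<le> 1 * (norm u * norm v)"
    unfolding mult.assoc by (rule mult_right_mono) (use T in auto)
  also have "\<dots> \<le> ((norm u)\<^sup>2 + (norm v)\<^sup>2) / 2"
    using sum_squares_bound[of "norm u" "norm v"] by simp
  also have "(norm u)\<^sup>2 = ?R"
    by (simp add: u_def norm_add_sq cinner_scaleC_right norm_scaleC norm_mult x y z)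
  also have "(norm v)\<^sup>2 = ?R"
    by (simp add: v_def norm_add_sq cinner_scaleC_right cinner_scaleC_left norm_scaleC x y z mult.assoc)
  also have "(?R + ?R) / 2 = ?R"
    by (rule field_sum_of_halves[unfolded add_divide_distrib[symmetric]])
  finally show ?thesis .
qed

text \<open>Cauchy's integral formula for the \<open>k\<close>-th derivative at the centre of the circle.\<close>
lemma circle_mean_coeff:
  assumes g: "g holomorphic_on ball 0 1" and \<rho>: "0 < \<rho>" "\<rho> < 1"
  shows "((\<lambda>t. cis (- (2 * pi * real k * t)) * g (of_real \<rho> * cis (2 * pi * t)))
    has_integral of_real \<rho> ^ k * fps_nth (fps_expansion g 0) k) {0..1}"
proof -
  have "continuous_on (cball 0 \<rho>) g" "g holomorphic_on ball 0 \<rho>"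
    using \<rho> by (auto intro!: holomorphic_on_imp_continuous_on holomorphic_on_subset[OF g])
  from Cauchy_has_contour_integral_higher_derivative_circlepath[OF this, of 0 k] \<rho>
  have "((\<lambda>t. g (circlepath 0 \<rho> t) / circlepath 0 \<rho> t ^ Suc k *
      (2 * pi * \<i> * \<rho> * exp (2 * of_real pi * \<i> * t)))
    has_integral (2 * pi * \<i>) / fact k * (deriv ^^ k) g 0) {0..1}"
    by (simp add: has_contour_integral vector_derivative_circlepath)
  from has_integral_mult_right[OF this, of "of_real \<rho> ^ k / (2 * pi * \<i>)"]
  have I: "((\<lambda>t. of_real \<rho> ^ k / (2 * pi * \<i>) * (g (circlepath 0 \<rho> t) / circlepath 0 \<rho> t ^ Suc k *
      (2 * pi * \<i> * \<rho> * exp (2 * of_real pi * \<i> * t))))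
    has_integral of_real \<rho> ^ k * fps_nth (fps_expansion g 0) k) {0..1}"
    by (simp add: fps_expansion_def mult_ac)
  have "of_real \<rho> ^ k / (2 * pi * \<i>) * (g (circlepath 0 \<rho> t) / circlepath 0 \<rho> t ^ Suc k *
      (2 * pi * \<i> * \<rho> * exp (2 * of_real pi * \<i> * t)))
    = cis (- (2 * pi * real k * t)) * g (of_real \<rho> * cis (2 * pi * t))" for t
  proof -
    have e: "exp (2 * of_real pi * \<i> * of_real t) = cis (2 * pi * t)"
      by (simp add: cis_conv_exp mult_ac)
    have c: "cis (- (2 * pi * real k * t)) = inverse (cis (2 * pi * t) ^ k)"
      by (simp add: Complex.DeMoivre mult_ac)
    show ?thesis
      unfolding circlepath e c using \<rho> by (simp add: power_mult_distrib field_simps)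
  qed
  with I show ?thesis by simp
qed

text \<open>The positive frequency \<open>k\<close> picks out the value at \<open>0\<close> of \<open>w\<^sup>k g(w)\<close>.\<close>
lemma circle_mean_zero:
  assumes g: "g holomorphic_on ball 0 1" and \<rho>: "0 < \<rho>" "\<rho> < 1" and "0 < k"
  shows "((\<lambda>t. cis (2 * pi * real k * t) * g (of_real \<rho> * cis (2 * pi * t))) has_integral 0) {0..1}"
proof -
  have "(\<lambda>w. w ^ k * g w) holomorphic_on ball 0 1"
    by (intro holomorphic_intros g)
  from circle_mean_coeff[OF this \<rho>, of 0]
  have "((\<lambda>t. (of_real \<rho> * cis (2 * pi * t)) ^ k * g (of_real \<rho> * cis (2 * pi * t)))
      has_integral 0) {0..1}"
    using \<open>0 < k\<close> by (simp add: fps_expansion_def power_0_left)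
  from has_integral_mult_right[OF this, of "inverse (of_real \<rho> ^ k)"]
  have "((\<lambda>t. inverse (of_real \<rho> ^ k) * ((of_real \<rho> * cis (2 * pi * t)) ^ k
      * g (of_real \<rho> * cis (2 * pi * t)))) has_integral 0) {0..1}"
    by simp
  moreover have "inverse (of_real \<rho> ^ k) * ((of_real \<rho> * cis (2 * pi * t)) ^ k * v)
      = cis (2 * pi * real k * t) * v" for t and v :: complex
    using \<rho> by (simp add: power_mult_distrib Complex.DeMoivre mult_ac)
  ultimately show ?thesis
    by simp
qed

text \<open>Integrating \<open>contraction_pairing_le\<close> over a circle of radius \<open>\<rho>\<close>, with \<open>z\<close> the \<open>k\<close>-th power
  of the unimodular variable, compares \<open>2\<alpha>\<mu> + \<rho>\<^sup>k \<langle>C\<^sub>k x, y\<rangle>\<close> with \<open>1 + |\<mu>|\<^sup>2\<close>, where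
  \<open>\<langle>C\<^sub>k x, y\<rangle>\<close> is the coefficient to be estimated. The bound follows as \<open>\<rho>\<close> tends to \<open>1\<close>.\<close>
lemma scalar_start_coeff_bound:
  fixes S :: "complex \<Rightarrow> 'h::complex_hilbert bounded_op"
  assumes hol: "\<And>x y. (\<lambda>w. matrix_coeff x y (S w)) holomorphic_on ball 0 1"
    and S: "\<And>w. w \<in> ball 0 1 \<Longrightarrow> norm (S w) \<le> 1"
    and S0: "S 0 = \<alpha> *\<^sub>C id_op"
    and x: "norm x = 1" and y: "norm y = 1" and k: "0 < k"
  shows "cmod (fps_nth (fps_expansion (\<lambda>w. matrix_coeff x y (S w)) 0) k) \<le> 1 - (cmod \<alpha>)\<^sup>2"
proof -
  define g where "g = (\<lambda>x y w. matrix_coeff x y (S w))"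
  define c where "c = fps_nth (fps_expansion (g x y) 0) k"
  \<comment> \<open>The phase that rotates the coefficient to the positive real axis.\<close>
  obtain \<sigma> where \<sigma>: "cmod \<sigma> = 1" "\<sigma> * c = of_real (cmod c)"
  proof (cases "c = 0")
    case False
    then show ?thesis
      by (intro that[of "cnj c / cmod c"])
        (simp_all add: norm_divide power2_eq_square field_simps flip: complex_norm_square)
  qed (auto intro: that[of 1])
  \<comment> \<open>With this \<open>\<mu>\<close> the product \<open>\<sigma>\<alpha>\<mu> = |\<alpha>|\<^sup>2\<close> is positive too, and \<open>1 + t\<^sup>2 - 2 |\<alpha>| t\<close> is minimal at \<open>t = |\<mu>| = |\<alpha>|\<close>.\<close>
  define \<mu> where "\<mu> = cnj (\<alpha> * \<sigma>)"
  have \<mu>: "cmod \<mu> = cmod \<alpha>"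
    using \<sigma> by (simp add: \<mu>_def norm_mult)
  have g0: "fps_nth (fps_expansion (g v v) 0) 0 = \<alpha>" if "norm v = 1" for v
    using that
    by (simp add: fps_expansion_def g_def S0 matrix_coeff_scaleC)
       (simp add: matrix_coeff_def id_op.rep_eq cinner_self)
  have "\<rho> ^ k * cmod c \<le> 1 - (cmod \<alpha>)\<^sup>2" if \<rho>: "0 < \<rho>" "\<rho> < 1" for \<rho>
  proof -
    define e where "e = (\<lambda>t. of_real \<rho> * cis (2 * pi * t))"
    define z where "z = (\<lambda>t. cis (2 * pi * real k * t))"
    have cz: "cnj (z t) = cis (- (2 * pi * real k * t))" for t
      by (simp add: z_def cis_cnj)
    have h: "g u v holomorphic_on ball 0 1" for u v
      using hol by (simp add: g_def)
    have mean0: "((\<lambda>t. g v v (e t)) has_integral \<alpha>) {0..1}" if "norm v = 1" for v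
      using circle_mean_coeff[OF h[of v v] \<rho>, of 0] g0[OF that] by (simp add: e_def)
    have meank: "((\<lambda>t. cnj (z t) * g x y (e t)) has_integral of_real \<rho> ^ k * c) {0..1}"
      using circle_mean_coeff[OF h[of x y] \<rho>, of k] by (simp add: e_def cz c_def)
    have meanz: "((\<lambda>t. z t * g y x (e t)) has_integral 0) {0..1}"
      using circle_mean_zero[OF h[of y x] \<rho> k] by (simp add: e_def z_def)
    have mean1: "((\<lambda>t. cnj (z t)) has_integral 0) {0..1}"
    proof -
      have "((\<lambda>t. z t) has_integral 0) {0..1}"
        using circle_mean_zero[of "\<lambda>_. 1", OF _ \<rho> k] by (simp add: z_def)
      then show ?thesis
        using has_integral_cnj[of z 0 "{0..1}"] by (simp add: o_def)
    qed
    \<comment> \<open>the left-hand side of the pairing inequality along the circle\<close>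
    define L where "L = (\<lambda>t. \<mu> * g x x (e t) + \<mu> * g y y (e t)
      + cnj (z t) * g x y (e t) + \<mu>\<^sup>2 * (z t * g y x (e t)))"
    have "(L has_integral \<mu> * \<alpha> + \<mu> * \<alpha> + of_real \<rho> ^ k * c + \<mu>\<^sup>2 * 0) {0..1}"
      unfolding L_def
      by (intro has_integral_add has_integral_mult_right mean0 meank meanz x y)
    from has_integral_mult_right[OF this, of \<sigma>]
    have IL: "((\<lambda>t. Re (\<sigma> * L t)) has_integral
        Re (\<sigma> * (\<mu> * \<alpha> + \<mu> * \<alpha> + of_real \<rho> ^ k * c + \<mu>\<^sup>2 * 0))) {0..1}"
      by (rule has_integral_linear[OF _ bounded_linear_Re, unfolded o_def])
    have "((\<lambda>t. Re (cnj \<mu> * cinner x y * cnj (z t))) has_integral Re (cnj \<mu> * cinner x y * 0)) {0..1}"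
      by (intro has_integral_linear[OF _ bounded_linear_Re, unfolded o_def] has_integral_mult_right mean1)
    then have "((\<lambda>t. (1 + (cmod \<mu>)\<^sup>2) + 2 * Re (cnj \<mu> * cinner x y * cnj (z t))) has_integral
        (1 + (cmod \<mu>)\<^sup>2) * 1 + 2 * Re (cnj \<mu> * cinner x y * 0)) {0..1}"
      using has_integral_const_real[of "1 + (cmod \<mu>)\<^sup>2" 0 1]
      by (intro has_integral_add has_integral_mult_right) (simp_all add: mult.commute)
    with IL have "Re (\<sigma> * (\<mu> * \<alpha> + \<mu> * \<alpha> + of_real \<rho> ^ k * c + \<mu>\<^sup>2 * 0)) \<le>
        (1 + (cmod \<mu>)\<^sup>2) * 1 + 2 * Re (cnj \<mu> * cinner x y * 0)"
    proof (rule has_integral_le)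
      fix t
      have et: "e t \<in> ball 0 1"
        using \<rho> by (simp add: e_def norm_mult)
      have "Re (\<sigma> * L t) \<le> cmod (L t)"
        using complex_Re_le_cmod[of "\<sigma> * L t"] \<sigma> by (simp add: norm_mult)
      also have "\<dots> \<le> 1 + (cmod \<mu>)\<^sup>2 + 2 * Re (cnj (z t) * cnj \<mu> * cinner x y)"
        using contraction_pairing_le[OF S[OF et] x y, of "z t" \<mu>]
        by (simp add: L_def g_def z_def mult_ac)
      finally show "Re (\<sigma> * L t) \<le> (1 + (cmod \<mu>)\<^sup>2) + 2 * Re (cnj \<mu> * cinner x y * cnj (z t))"
        by (simp add: mult_ac)
    qed
    also have "\<sigma> * (\<mu> * \<alpha> + \<mu> * \<alpha> + of_real \<rho> ^ k * c + \<mu>\<^sup>2 * 0)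
        = 2 * ((\<alpha> * \<sigma>) * \<mu>) + of_real \<rho> ^ k * (\<sigma> * c)"
      by (simp add: algebra_simps)
    also have "(\<alpha> * \<sigma>) * \<mu> = of_real ((cmod \<alpha>)\<^sup>2)"
      unfolding \<mu>_def complex_norm_square[symmetric] by (simp add: norm_mult \<sigma>(1))
    finally show ?thesis
      by (simp add: \<sigma> \<mu> flip: of_real_power)
  qed
  then have "\<forall>\<^sub>F \<rho> in at_left 1. \<rho> ^ k * cmod c \<le> 1 - (cmod \<alpha>)\<^sup>2"
    using eventually_at_left_real[of 0 1] by (auto elim!: eventually_mono)
  moreover have "((\<lambda>\<rho>. \<rho> ^ k * cmod c) \<longlongrightarrow> 1 ^ k * cmod c) (at_left (1::real))"
    by (intro tendsto_intros)
  ultimately have "1 ^ k * cmod c \<le> 1 - (cmod \<alpha>)\<^sup>2"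
    by (intro tendsto_upperbound) auto
  then show ?thesis
    by (simp add: c_def g_def)
qed

section \<open>The conformal map between the unit disk and the larger disk\<close>

lemma one_plus_complex_neq_0: "0 \<le> \<gamma> \<Longrightarrow> 1 + complex_of_real \<gamma> \<noteq> 0"
  by (simp add: complex_eq_iff)

text \<open>The larger disk is the preimage of the unit disk under \<open>z \<mapsto> z / (1 + \<gamma> - \<gamma> z)\<close>. In terms of
  squared moduli, \<open>|(1 - \<gamma>) z + \<gamma>|\<^sup>2 - 1\<close> is \<open>|z|\<^sup>2 - |1 + \<gamma> - \<gamma> z|\<^sup>2\<close> times the positive
  factor \<open>(1 - \<gamma>) / (1 + \<gamma>)\<close>.\<close>
lemma Omega_disk_iff:
  assumes "0 \<le> \<gamma>" "\<gamma> < 1"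
  shows "z \<in> Omega_disk \<gamma> \<longleftrightarrow> cmod z < cmod (1 + of_real \<gamma> - of_real \<gamma> * z)"
proof -
  define x y where "x = Re z" and "y = Im z"
  have "z \<in> Omega_disk \<gamma> \<longleftrightarrow> (1 - \<gamma>) * cmod (z + complex_of_real (\<gamma> / (1 - \<gamma>))) < 1"
    using assms by (simp add: Omega_disk_def field_simps)
  also have "(1 - \<gamma>) * cmod (z + complex_of_real (\<gamma> / (1 - \<gamma>)))
      = cmod (of_real (1 - \<gamma>) * (z + complex_of_real (\<gamma> / (1 - \<gamma>))))"
    using assms by (simp add: norm_mult del: of_real_diff)
  also have "of_real (1 - \<gamma>) * (z + complex_of_real (\<gamma> / (1 - \<gamma>))) = of_real (1 - \<gamma>) * z + of_real \<gamma>"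
  proof -
    have "(1 - \<gamma>) * (\<gamma> / (1 - \<gamma>)) = \<gamma>"
      using assms by simp
    then show ?thesis
      unfolding distrib_left of_real_mult[symmetric] by simp
  qed
  also have "cmod (of_real (1 - \<gamma>) * z + of_real \<gamma>) < 1 \<longleftrightarrow>
      (cmod (of_real (1 - \<gamma>) * z + of_real \<gamma>))\<^sup>2 < 1"
    by (simp add: abs_square_less_1)
  also have "\<dots> \<longleftrightarrow> ((1 - \<gamma>) * x + \<gamma>)\<^sup>2 + ((1 - \<gamma>) * y)\<^sup>2 < 1"
    by (simp add: cmod_power2 x_def y_def)
  also have "\<dots> \<longleftrightarrow> (1 + \<gamma>) * (((1 - \<gamma>) * x + \<gamma>)\<^sup>2 + ((1 - \<gamma>) * y)\<^sup>2 - 1) < 0"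
    using assms by (simp add: mult_less_0_iff)
  also have "(1 + \<gamma>) * (((1 - \<gamma>) * x + \<gamma>)\<^sup>2 + ((1 - \<gamma>) * y)\<^sup>2 - 1)
      = (1 - \<gamma>) * (x\<^sup>2 + y\<^sup>2 - ((1 + \<gamma> - \<gamma> * x)\<^sup>2 + (\<gamma> * y)\<^sup>2))"
    by (simp add: power2_eq_square algebra_simps)
  also have "\<dots> < 0 \<longleftrightarrow> x\<^sup>2 + y\<^sup>2 < (1 + \<gamma> - \<gamma> * x)\<^sup>2 + (\<gamma> * y)\<^sup>2"
    using assms by (simp add: mult_less_0_iff)
  also have "\<dots> \<longleftrightarrow> (cmod z)\<^sup>2 < (cmod (1 + of_real \<gamma> - of_real \<gamma> * z))\<^sup>2"
    by (simp add: cmod_power2 x_def y_def)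
  also have "\<dots> \<longleftrightarrow> cmod z < cmod (1 + of_real \<gamma> - of_real \<gamma> * z)"
    using abs_le_square_iff[of "cmod (1 + of_real \<gamma> - of_real \<gamma> * z)" "cmod z"]
    unfolding linorder_not_le[symmetric] by (simp only: abs_norm_cancel)
  finally show ?thesis .
qed

lemma ball_subset_Omega_disk:
  assumes "0 \<le> \<gamma>" "\<gamma> < 1"
  shows "ball 0 1 \<subseteq> Omega_disk \<gamma>"
proof
  fix z :: complex assume z: "z \<in> ball 0 1"
  have "\<gamma> * cmod z \<le> \<gamma>"
    using z assms by (simp add: mult_left_le)
  moreover have "1 + \<gamma> - \<gamma> * cmod z \<le> cmod (1 + of_real \<gamma> - of_real \<gamma> * z)"
    using norm_triangle_ineq2[of "of_real (1 + \<gamma>)" "of_real \<gamma> * z"] assms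
    unfolding norm_mult norm_of_real by simp
  ultimately show "z \<in> Omega_disk \<gamma>"
    using z by (simp add: Omega_disk_iff[OF assms])
qed

text \<open>The inverse of \<open>z \<mapsto> z / (1 + \<gamma> - \<gamma> z)\<close>.\<close>
definition disk_to_Omega where "disk_to_Omega \<gamma> w = (1 + of_real \<gamma>) * w / (1 + of_real \<gamma> * (w::complex))"

lemma disk_to_Omega_mem:
  assumes "0 \<le> \<gamma>" "\<gamma> < 1" "w \<in> ball 0 1"
  shows "disk_to_Omega \<gamma> w \<in> Omega_disk \<gamma>" "1 + of_real \<gamma> * w \<noteq> 0"
    and "disk_to_Omega \<gamma> w / (1 + of_real \<gamma> - of_real \<gamma> * disk_to_Omega \<gamma> w) = w"
proof -
  have "cmod (of_real \<gamma> * w) < 1"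
    using assms by (simp add: norm_mult mult_less_le_imp_less mult_strict_mono' le_less_trans[OF mult_left_le])
  then show nz: "1 + of_real \<gamma> * w \<noteq> 0"
    by (metis add_eq_0_iff norm_minus_cancel norm_one order_less_irrefl)
  have g: "1 + complex_of_real \<gamma> \<noteq> 0"
    using assms by (metis add_nonneg_eq_0_iff of_real_1 of_real_add of_real_eq_0_iff zero_le_one zero_neq_one)
  have d: "1 + of_real \<gamma> - of_real \<gamma> * disk_to_Omega \<gamma> w = (1 + of_real \<gamma>) / (1 + of_real \<gamma> * w)"
    using nz by (simp add: disk_to_Omega_def field_simps)
  show "disk_to_Omega \<gamma> w / (1 + of_real \<gamma> - of_real \<gamma> * disk_to_Omega \<gamma> w) = w"
    unfolding d using nz g by (simp add: disk_to_Omega_def)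
  show "disk_to_Omega \<gamma> w \<in> Omega_disk \<gamma>"
    unfolding Omega_disk_iff[OF assms(1,2)] d
    using assms nz g by (simp add: disk_to_Omega_def norm_divide norm_mult divide_strict_right_mono)
qed

lemma disk_to_Omega_inverse:
  assumes "0 \<le> \<gamma>" "1 + of_real \<gamma> - of_real \<gamma> * z \<noteq> 0"
  shows "disk_to_Omega \<gamma> (z / (1 + of_real \<gamma> - of_real \<gamma> * z)) = z"
proof -
  let ?d = "1 + of_real \<gamma> - of_real \<gamma> * z"
  have "1 + of_real \<gamma> * (z / ?d) = (1 + of_real \<gamma>) / ?d"
    using assms(2) by (simp add: field_simps)
  then show ?thesis
    using assms(2) one_plus_complex_neq_0[OF assms(1)] by (simp add: disk_to_Omega_def)
qed

text \<open>The Taylor series of \<open>z / (1 + \<gamma> - \<gamma> z)\<close> at \<open>0\<close>. The factor \<open>fps_X\<close> makes the vanishing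
  constant term explicit, as needed for composition.\<close>
definition Omega_to_disk_fps :: "real \<Rightarrow> complex fps"
  where "Omega_to_disk_fps \<gamma> = fps_X * Abs_fps (\<lambda>n. of_real (\<gamma> ^ n / (1 + \<gamma>) ^ Suc n))"

lemma Omega_to_disk_fps_power_nonneg: "0 \<le> \<gamma> \<Longrightarrow> fps_nth (Omega_to_disk_fps \<gamma> ^ i) n \<in> \<real>\<^sub>\<ge>\<^sub>0"
proof (induction i arbitrary: n)
  case (Suc i)
  moreover have "fps_nth (Omega_to_disk_fps \<gamma>) m \<in> \<real>\<^sub>\<ge>\<^sub>0" for m
    using Suc.prems by (cases m) (simp_all add: Omega_to_disk_fps_def del: of_real_divide of_real_power of_real_mult of_real_add)
  ultimately have "fps_nth (Omega_to_disk_fps \<gamma>) a * fps_nth (Omega_to_disk_fps \<gamma> ^ i) b \<in> \<real>\<^sub>\<ge>\<^sub>0" for a b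
    by (intro nonneg_Reals_mult_I) auto
  then show ?case
    by (simp add: fps_mult_nth) (simp add: complex_nonneg_Reals_iff sum_nonneg)
qed (simp add: fps_one_nth)

lemma Omega_to_disk_fps_eq:
  assumes "0 \<le> \<gamma>"
  shows "Omega_to_disk_fps \<gamma> * (fps_const (1 + of_real \<gamma>) - fps_const (of_real \<gamma>) * fps_X) = fps_X"
    (is "?U * ?D = _")
proof (rule fps_ext)
  fix n
  have "?U * ?D = fps_const (1 + of_real \<gamma>) * ?U - fps_const (of_real \<gamma>) * (fps_X * ?U)"
    by (simp add: algebra_simps)
  then have "fps_nth (?U * ?D) n = (1 + of_real \<gamma>) * fps_nth ?U n
        - of_real \<gamma> * (if n = 0 then 0 else fps_nth ?U (n - 1))"
    by (simp only: fps_sub_nth fps_mult_left_const_nth fps_X_mult_nth)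
  also have "\<dots> = fps_nth fps_X n"
  proof (cases n)
    case (Suc m)
    have "1 + complex_of_real \<gamma> \<noteq> 0"
      using assms by (simp add: complex_eq_iff)
    with Suc show ?thesis
      by (cases m) (simp_all add: Omega_to_disk_fps_def)
  qed (simp add: Omega_to_disk_fps_def)
  finally show "fps_nth (?U * ?D) n = fps_nth fps_X n" .
qed

lemma has_fps_expansion_Omega_to_disk_fps:
  assumes "0 \<le> \<gamma>"
  shows "(\<lambda>z. z / (1 + of_real \<gamma> - of_real \<gamma> * z)) has_fps_expansion Omega_to_disk_fps \<gamma>"
proof -
  let ?D = "fps_const (1 + complex_of_real \<gamma>) - fps_const (of_real \<gamma>) * fps_X"
  have D: "fps_nth ?D 0 \<noteq> 0"
    using one_plus_complex_neq_0[OF assms] by simp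
  have "(\<lambda>z. z / (1 + of_real \<gamma> - of_real \<gamma> * z)) has_fps_expansion fps_X / ?D"
    by (rule has_fps_expansion_divide'[OF _ _ D]) (intro fps_expansion_intros)+
  also have "fps_X / ?D = Omega_to_disk_fps \<gamma>"
    using D by (subst Omega_to_disk_fps_eq[OF assms, symmetric], intro nonzero_mult_div_cancel_right) auto
  finally show ?thesis .
qed

text \<open>With \<open>u\<close> the map \<open>z / (1 + \<gamma> - \<gamma> z)\<close>, non-negativity turns the sum into the \<open>n\<close>-th coefficient of
  \<open>\<Sum>\<^sub>k u\<^sup>k = u / (1 - u)\<close>, and this function equals \<open>z / ((1 + \<gamma>)(1 - z))\<close>.\<close>
lemma Omega_to_disk_fps_power_sum:
  assumes "0 \<le> \<gamma>" "0 < n"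
  shows "(\<Sum>i=1..n. cmod (fps_nth (Omega_to_disk_fps \<gamma> ^ i) n)) = 1 / (1 + \<gamma>)"
proof -
  \<comment> \<open>\<open>E = X / (1 - X)\<close>, to be composed with \<open>u\<close>\<close>
  define E :: "complex fps" where "E = Abs_fps (\<lambda>n. if n = 0 then 0 else 1)"
  let ?U = "Omega_to_disk_fps \<gamma>"
  let ?c = "1 + complex_of_real \<gamma>"
  let ?D = "fps_const ?c - fps_const (of_real \<gamma>) * fps_X"
  have E: "E * (1 - fps_X) = fps_X"
    by (rule fps_ext) (auto simp: E_def algebra_simps)
  have U0: "fps_nth ?U 0 = 0"
    by (simp add: Omega_to_disk_fps_def)
  have "(E oo ?U) * (1 - ?U) = ?U"
    using arg_cong[OF E, of "\<lambda>F. F oo ?U"]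
    by (simp add: fps_compose_mult_distrib[OF U0] fps_compose_sub_distrib
        fps_X_fps_compose_startby0[OF U0])
  then have "(E oo ?U) * (?D - ?U * ?D) = ?U * ?D"
    by (metis left_diff_distrib mult.assoc mult_1)
  then have "(E oo ?U) * (?D - fps_X) = E * (1 - fps_X)"
    unfolding Omega_to_disk_fps_eq[OF assms(1)] E .
  moreover have "?D - fps_X = fps_const ?c * (1 - fps_X)"
    by (simp add: algebra_simps flip: fps_const_add)
  ultimately have "fps_const ?c * (E oo ?U) * (1 - fps_X) = E * (1 - fps_X)"
    by (simp only: mult_ac)
  moreover have "(1 - fps_X :: complex fps) \<noteq> 0"
    by (metis fps_X_neq_one right_minus_eq)
  ultimately have "fps_const ?c * (E oo ?U) = E"
    by simp
  then have "?c * fps_nth (E oo ?U) n = fps_nth E n"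
    by (metis fps_mult_left_const_nth)
  moreover have "fps_nth (E oo ?U) n = (\<Sum>i=1..n. fps_nth (?U ^ i) n)"
    unfolding fps_compose_nth using \<open>0 < n\<close>
    by (subst sum.atLeast_Suc_atMost) (auto simp: E_def intro!: sum.cong)
  ultimately have "of_real (1 + \<gamma>) * (\<Sum>i=1..n. fps_nth (?U ^ i) n) = of_real 1"
    using assms by (simp add: E_def)
  then have "(1 + \<gamma>) * Re (\<Sum>i=1..n. fps_nth (?U ^ i) n) = 1"
    using Re_complex_of_real by (metis scaleR_complex.sel(1) scaleR_conv_of_real)
  moreover have "cmod (fps_nth (?U ^ i) n) = Re (fps_nth (?U ^ i) n)" for i
    using Omega_to_disk_fps_power_nonneg[OF assms(1), of i n]
    by (auto simp: complex_nonneg_Reals_iff cmod_eq_Re)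
  ultimately show ?thesis
    using assms by (simp add: field_simps)
qed

section \<open>Taylor coefficients on the larger disk\<close>

text \<open>The function is pulled back to the unit disk, where \<open>scalar_start_coeff_bound\<close> applies to each
  coefficient; recomposition with the conformal map mixes these bounds with non-negative weights
  that add up to \<open>1 / (1 + \<gamma>)\<close>.\<close>
lemma scalar_start_coeff_bound_Omega:
  fixes f :: "complex \<Rightarrow> 'h::complex_hilbert bounded_op"
  assumes \<gamma>: "0 \<le> \<gamma>" "\<gamma> < 1"
    and f: "f \<in> H_inf (Omega_disk \<gamma>)" "H_inf_norm (Omega_disk \<gamma>) f \<le> 1"
    and A: "has_expansion f A" and A0: "A 0 = \<alpha> *\<^sub>C id_op" and \<alpha>: "cmod \<alpha> \<le> 1" and n: "0 < n"
  shows "norm (A n) \<le> (1 - (cmod \<alpha>)\<^sup>2) / (1 + \<gamma>)"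
proof (rule op_norm_le_matrix_coeff)
  show "0 \<le> (1 - (cmod \<alpha>)\<^sup>2) / (1 + \<gamma>)"
    using \<gamma> \<alpha> by (simp add: power_le_one)
next
  fix x y :: 'h assume x: "norm x = 1" and y: "norm y = 1"
  let ?U = "Omega_to_disk_fps \<gamma>"
  define S where "S = (\<lambda>w. f (disk_to_Omega \<gamma> w))"
  define G where "G = (\<lambda>w. matrix_coeff x y (S w))"
  define C where "C = fps_expansion G 0"
  define u where "u = (\<lambda>z::complex. z / (1 + of_real \<gamma> - of_real \<gamma> * z))"
  have "disk_to_Omega \<gamma> holomorphic_on ball 0 1"
    unfolding disk_to_Omega_def using disk_to_Omega_mem(2)[OF \<gamma>] by (intro holomorphic_intros) auto
  moreover have "(\<lambda>z. matrix_coeff v w (f z)) holomorphic_on Omega_disk \<gamma>" for v w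
    using f by (intro matrix_coeff_holomorphic) (simp add: H_inf_def)
  moreover have "disk_to_Omega \<gamma> ` ball 0 1 \<subseteq> Omega_disk \<gamma>"
    using disk_to_Omega_mem(1)[OF \<gamma>] by blast
  ultimately have hol: "(\<lambda>w. matrix_coeff v v' (S w)) holomorphic_on ball 0 1" for v v'
    unfolding S_def by (rule holomorphic_on_compose_gen[unfolded o_def])
  have "f 0 = A 0"
    using A by (rule has_expansion_at_0)
  then have S0: "S 0 = \<alpha> *\<^sub>C id_op"
    by (simp add: S_def disk_to_Omega_def A0)
  have "norm (S w) \<le> 1" if "w \<in> ball 0 1" for w
    using norm_le_H_inf_norm[OF f(1) disk_to_Omega_mem(1)[OF \<gamma> that]] f(2) by (simp add: S_def)
  from scalar_start_coeff_bound[OF hol this S0 x y]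
  have C_le: "cmod (fps_nth C k) \<le> 1 - (cmod \<alpha>)\<^sup>2" if "0 < k" for k
    using that by (simp add: C_def G_def)
  have "(G \<circ> u) has_fps_expansion (C oo ?U)"
  proof (rule has_fps_expansion_compose)
    show "G has_fps_expansion C"
      unfolding C_def by (rule has_fps_expansion_fps_expansion[of "ball 0 1"]) (use hol in \<open>auto simp: G_def\<close>)
    show "u has_fps_expansion ?U"
      unfolding u_def by (rule has_fps_expansion_Omega_to_disk_fps) fact
  qed (simp add: Omega_to_disk_fps_def)
  moreover have "\<forall>\<^sub>F z in nhds 0. (G \<circ> u) z = matrix_coeff x y (f z)"
  proof -
    have "\<forall>\<^sub>F z in nhds 0. z \<in> {z. 1 + complex_of_real \<gamma> - of_real \<gamma> * z \<noteq> 0}"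
      using one_plus_complex_neq_0[OF \<gamma>(1)]
      by (intro eventually_nhds_in_open open_Collect_neq continuous_intros) auto
    then show ?thesis
      by eventually_elim (simp add: G_def S_def u_def disk_to_Omega_inverse \<gamma>)
  qed
  ultimately have "(\<lambda>z. matrix_coeff x y (f z)) has_fps_expansion (C oo ?U)"
    by (rule iffD1[OF has_fps_expansion_cong[OF _ refl], rotated])
  then have "matrix_coeff x y (A n) = fps_nth (C oo ?U) n"
    using fps_expansion_unique_complex has_fps_expansion_matrix_coeff[OF A] by (metis fps_nth_Abs_fps)
  also have "\<dots> = (\<Sum>i=1..n. fps_nth C i * fps_nth (?U ^ i) n)"
    unfolding fps_compose_nth using n by (subst sum.atLeast_Suc_atMost) auto
  finally have "cmod (matrix_coeff x y (A n)) = cmod (\<Sum>i=1..n. fps_nth C i * fps_nth (?U ^ i) n)"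
    by simp
  also have "\<dots> \<le> (\<Sum>i=1..n. (1 - (cmod \<alpha>)\<^sup>2) * cmod (fps_nth (?U ^ i) n))"
    by (intro sum_norm_le) (auto simp: norm_mult intro!: mult_right_mono C_le)
  also have "\<dots> = (1 - (cmod \<alpha>)\<^sup>2) / (1 + \<gamma>)"
    unfolding sum_distrib_left[symmetric] Omega_to_disk_fps_power_sum[OF \<gamma>(1) n] by simp
  finally show "cmod (matrix_coeff x y (A n)) \<le> (1 - (cmod \<alpha>)\<^sup>2) / (1 + \<gamma>)" .
qed

section \<open>The Bohr inequality\<close>

text \<open>Weighted arithmetic--geometric mean inequality for \<open>a\<^sup>2\<close> and \<open>1\<close> with weight \<open>p / 2\<close>.\<close>
lemma one_minus_powr_ge:
  fixes a p :: real
  assumes "0 \<le> a" "0 < p" "p \<le> 2"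
  shows "p / 2 * (1 - a\<^sup>2) \<le> 1 - a powr p"
proof (cases "a = 0")
  case False
  then have "(a\<^sup>2) powr (p / 2) * 1 powr (1 - p / 2) \<le> p / 2 * a\<^sup>2 + (1 - p / 2) * 1"
    using assms by (intro Youngs_inequality_0) auto
  moreover have "(a\<^sup>2) powr (p / 2) = a powr p"
    using False assms by (simp add: powr_powr flip: powr_numeral)
  ultimately show ?thesis
    by (simp add: algebra_simps)
qed (use assms in simp)

lemma weights_summable:
  assumes "\<phi> \<in> weights" "0 \<le> r" "r < 1"
  shows "summable (\<lambda>n. \<phi> n r)"
proof -
  have "\<exists>d>0. uniformly_convergent_on (ball r d \<inter> {0..<1}) (\<lambda>N s. \<Sum>n<N. \<phi> n s)"
    using assms by (simp add: weights_def)
  then obtain d where "d > 0" "uniformly_convergent_on (ball r d \<inter> {0..<1}) (\<lambda>N s. \<Sum>n<N. \<phi> n s)"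
    by blast
  then have "convergent (\<lambda>N. \<Sum>n<N. \<phi> n r)"
    using assms by (intro uniformly_convergent_imp_convergent[where X = "ball r d \<inter> {0..<1}"]) auto
  then show ?thesis
    by (simp add: summable_iff_convergent)
qed

lemma weights_nonneg: "\<phi> \<in> weights \<Longrightarrow> 0 \<le> r \<Longrightarrow> r < 1 \<Longrightarrow> 0 \<le> \<phi> n r"
  by (simp add: weights_def)

lemma bohr_inequality_summable:
  assumes "\<phi> \<in> weights" "0 \<le> r" "r < 1" and le: "\<And>n. norm (A (Suc n)) \<le> M"
  shows "summable (\<lambda>n. norm (A (Suc n)) * \<phi> (Suc n) r)"
    and "(\<Sum>n. norm (A (Suc n)) * \<phi> (Suc n) r) \<le> M * (\<Sum>n. \<phi> (Suc n) r)"
proof -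
  have summ: "summable (\<lambda>n. M * \<phi> (Suc n) r)"
    using weights_summable[OF assms(1-3)] by (intro summable_mult) (subst summable_Suc_iff)
  have le': "norm (A (Suc n)) * \<phi> (Suc n) r \<le> M * \<phi> (Suc n) r" for n
    using weights_nonneg[OF assms(1-3)] le by (intro mult_right_mono)
  show summ': "summable (\<lambda>n. norm (A (Suc n)) * \<phi> (Suc n) r)"
    by (rule summable_comparison_test'[OF summ]) (use le' weights_nonneg[OF assms(1-3)] in auto)
  have "(\<Sum>n. norm (A (Suc n)) * \<phi> (Suc n) r) \<le> (\<Sum>n. M * \<phi> (Suc n) r)"
    by (intro suminf_le le' summ summ')
  also have "\<dots> = M * (\<Sum>n. \<phi> (Suc n) r)"
    using weights_summable[OF assms(1-3)] by (intro suminf_mult) (subst summable_Suc_iff)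
  finally show "(\<Sum>n. norm (A (Suc n)) * \<phi> (Suc n) r) \<le> M * (\<Sum>n. \<phi> (Suc n) r)" .
qed

text \<open>The coefficient estimate bounds the series by \<open>(1 - |\<alpha>|\<^sup>2) / (1 + \<gamma>) \<Sum> \<phi>\<^sub>n\<close>, the comparison of
  the weights bounds this by \<open>p/2 (1 - |\<alpha>|\<^sup>2) \<phi>\<^sub>0\<close>, and the last expression is at most
  \<open>(1 - |\<alpha>|\<^sup>p) \<phi>\<^sub>0\<close>.\<close>
lemma bohr_inequality:
  fixes f :: "complex \<Rightarrow> 'h::complex_hilbert bounded_op"
  assumes \<gamma>: "0 \<le> \<gamma>" "\<gamma> < 1" and p: "0 < p" "p \<le> 2"
    and \<phi>: "\<phi> \<in> weights" and r: "0 \<le> r" "r < 1"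
    and le: "2 / (p * (1 + \<gamma>)) * (\<Sum>n. \<phi> (Suc n) r) \<le> \<phi> 0 r"
    and f: "f \<in> H_inf (Omega_disk \<gamma>)" "H_inf_norm (Omega_disk \<gamma>) f \<le> 1"
    and A: "has_expansion f A" and A0: "A 0 = \<alpha> *\<^sub>C id_op" and \<alpha>: "cmod \<alpha> \<le> 1"
  shows "norm (A 0) powr p * \<phi> 0 r + (\<Sum>n. norm (A (Suc n)) * \<phi> (Suc n) r) \<le> \<phi> 0 r"
proof -
  let ?a = "cmod \<alpha>" and ?S = "\<Sum>n. \<phi> (Suc n) r"
  have a2: "0 \<le> 1 - ?a\<^sup>2"
    using \<alpha> by (simp add: power_le_one)
  have \<phi>0: "0 \<le> \<phi> 0 r"
    by (rule weights_nonneg[OF \<phi> r])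
  have "norm (A 0) \<le> ?a"
    unfolding A0 norm_scaleC by (rule mult_left_le[OF norm_id_op_le]) simp
  then have "norm (A 0) powr p * \<phi> 0 r \<le> ?a powr p * \<phi> 0 r"
    using p \<phi>0 by (intro mult_right_mono powr_mono2) auto
  moreover have "(\<Sum>n. norm (A (Suc n)) * \<phi> (Suc n) r) \<le> (1 - ?a powr p) * \<phi> 0 r"
  proof -
    have "(\<Sum>n. norm (A (Suc n)) * \<phi> (Suc n) r) \<le> (1 - ?a\<^sup>2) / (1 + \<gamma>) * ?S"
      by (intro bohr_inequality_summable \<phi> r scalar_start_coeff_bound_Omega[OF \<gamma> f A A0 \<alpha>]) simp
    also have "\<dots> = p / 2 * (1 - ?a\<^sup>2) * (2 / (p * (1 + \<gamma>)) * ?S)"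
      using p by simp
    also have "\<dots> \<le> p / 2 * (1 - ?a\<^sup>2) * \<phi> 0 r"
      using a2 p by (intro mult_left_mono le) auto
    also have "\<dots> \<le> (1 - ?a powr p) * \<phi> 0 r"
      using p \<phi>0 by (intro mult_right_mono one_minus_powr_ge) auto
    finally show ?thesis .
  qed
  ultimately show ?thesis
    by (simp add: left_diff_distrib)
qed

section \<open>Extremal functions\<close>

lemma bounded_linear_scaleC_left: "bounded_linear (\<lambda>c. c *\<^sub>C (T::'x::complex_normed_vector))"
proof (rule bounded_linear_intro[where K = "norm T"])
  show "(t *\<^sub>R c) *\<^sub>C T = t *\<^sub>R c *\<^sub>C T" for t c
    by (simp add: scaleR_conv_of_real flip: scaleC_of_real scaleC_scaleC)
qed (simp_all add: scaleC_add_left norm_scaleC)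

lemma analytic_fun_scaleC:
  assumes "g holomorphic_on \<Omega>"
  shows "analytic_fun \<Omega> (\<lambda>z. g z *\<^sub>C (T::'x::{complex_normed_vector,banach}))"
  unfolding analytic_fun_def
proof
  fix z assume "z \<in> \<Omega>"
  then obtain D where "(g has_derivative (\<lambda>h. D * h)) (at z within \<Omega>)"
    using assms by (auto simp: holomorphic_on_def field_differentiable_def has_field_derivative_def)
  from bounded_linear.has_derivative[OF bounded_linear_scaleC_left this]
  show "\<exists>D. ((\<lambda>z. g z *\<^sub>C T) has_derivative (\<lambda>h. h *\<^sub>C D)) (at z within \<Omega>)"
    by (intro exI[of _ "D *\<^sub>C T"]) (simp add: scaleC_scaleC mult.commute)
qed

lemma has_expansion_scaleC:
  assumes "\<And>z. z \<in> ball 0 1 \<Longrightarrow> (\<lambda>n. c n * z ^ n) sums g z"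
  shows "has_expansion (\<lambda>z. g z *\<^sub>C T) (\<lambda>n. c n *\<^sub>C (T::'x::{complex_normed_vector,banach}))"
  unfolding has_expansion_def
proof
  fix z :: complex assume "z \<in> ball 0 1"
  from bounded_linear.sums[OF bounded_linear_scaleC_left assms[OF this]]
  show "(\<lambda>n. z ^ n *\<^sub>C c n *\<^sub>C T) sums (g z *\<^sub>C T)"
    by (simp add: scaleC_scaleC mult.commute)
qed

text \<open>This is \<open>(a - u) / (1 - a u)\<close> with \<open>u = z / (1 + \<gamma> - \<gamma> z)\<close>, with the fraction in \<open>u\<close> cleared.\<close>
definition extremal :: "real \<Rightarrow> real \<Rightarrow> complex \<Rightarrow> complex"
  where "extremal \<gamma> a z =
    (of_real a * (1 + of_real \<gamma> - of_real \<gamma> * z) - z) / (1 + of_real \<gamma> - of_real \<gamma> * z - of_real a * z)"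

definition extremal_coeff :: "real \<Rightarrow> real \<Rightarrow> nat \<Rightarrow> real"
  where "extremal_coeff \<gamma> a n =
    (case n of 0 \<Rightarrow> a | Suc m \<Rightarrow> - ((1 - a\<^sup>2) / (1 + \<gamma>) * ((\<gamma> + a) / (1 + \<gamma>)) ^ m))"

text \<open>With \<open>d = 1 + \<gamma> - \<gamma> z\<close>, numerator and denominator are \<open>a d - z\<close> and \<open>d - a z\<close>, so that the
  identity behind the Schwarz--Pick lemma applies in homogeneous form.\<close>
lemma extremal_bounds:
  assumes \<gamma>: "0 \<le> \<gamma>" "\<gamma> < 1" and a: "0 \<le> a" "a < 1" and z: "z \<in> Omega_disk \<gamma>"
  shows "1 + of_real \<gamma> - of_real \<gamma> * z - of_real a * z \<noteq> 0" "cmod (extremal \<gamma> a z) \<le> 1"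
proof -
  define d where "d = 1 + of_real \<gamma> - of_real \<gamma> * z"
  have zd: "cmod z < cmod d"
    using z by (simp add: Omega_disk_iff[OF \<gamma>] d_def)
  have "cmod (of_real a * z) \<le> cmod z"
    using a by (simp add: norm_mult mult_left_le_one_le)
  with zd have nz: "d - of_real a * z \<noteq> 0"
    by force
  then show "1 + of_real \<gamma> - of_real \<gamma> * z - of_real a * z \<noteq> 0"
    by (simp add: d_def)
  have "(cmod (d - of_real a * z))\<^sup>2 - (cmod (of_real a * d - z))\<^sup>2
      = (1 - a\<^sup>2) * ((cmod d)\<^sup>2 - (cmod z)\<^sup>2)"
    by (simp add: cmod_power2) (simp add: power2_eq_square algebra_simps)
  also have "\<dots> \<ge> 0"
    using a zd by (intro mult_nonneg_nonneg) (auto simp: power_le_one intro: power_mono)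
  finally have "(cmod (of_real a * d - z))\<^sup>2 \<le> (cmod (d - of_real a * z))\<^sup>2"
    by simp
  then have "cmod (of_real a * d - z) \<le> cmod (d - of_real a * z)"
    by (rule power2_le_imp_le) simp
  then show "cmod (extremal \<gamma> a z) \<le> 1"
    using nz by (simp add: extremal_def norm_divide divide_le_eq_1 flip: d_def)
qed

lemma extremal_sums:
  assumes \<gamma>: "0 \<le> \<gamma>" "\<gamma> < 1" and a: "0 \<le> a" "a < 1" and z: "z \<in> ball 0 1"
  shows "(\<lambda>n. of_real (extremal_coeff \<gamma> a n) * z ^ n) sums extremal \<gamma> a z"
proof -
  define q where "q = (\<gamma> + a) / (1 + \<gamma>)"
  define k where "k = - ((1 - a\<^sup>2) / (1 + \<gamma>))"
  have q: "0 \<le> q" "q < 1"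
    using \<gamma> a by (simp_all add: q_def)
  have "cmod (of_real q * z) \<le> cmod z"
    using q by (simp add: norm_mult mult_left_le_one_le)
  with z have "cmod (of_real q * z) < 1"
    by simp
  then have "(\<lambda>n. of_real k * z * (of_real q * z) ^ n) sums (of_real k * z * (1 / (1 - of_real q * z)))"
    by (intro sums_mult geometric_sums)
  moreover have extremal_coeff_Suc: "extremal_coeff \<gamma> a (Suc n) = k * q ^ n" for n
    by (simp only: extremal_coeff_def k_def q_def nat.case mult_minus_left)
  ultimately have "(\<lambda>n. of_real (extremal_coeff \<gamma> a (Suc n)) * z ^ Suc n) sums
      (of_real k * z / (1 - of_real q * z))"
    by (simp add: extremal_coeff_Suc power_mult_distrib mult_ac)
  then have "(\<lambda>n. of_real (extremal_coeff \<gamma> a n) * z ^ n) sums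
      (of_real k * z / (1 - of_real q * z) + of_real a)"
    by (subst (asm) sums_Suc_iff) (simp add: extremal_coeff_def)
  also have "of_real k * z / (1 - of_real q * z) + of_real a = extremal \<gamma> a z"
  proof -
    let ?c = "1 + complex_of_real \<gamma>"
    let ?d = "?c - of_real \<gamma> * z - of_real a * z"
    have c: "?c \<noteq> 0"
      by (rule one_plus_complex_neq_0[OF \<gamma>(1)])
    have d: "?d \<noteq> 0"
      using extremal_bounds(1)[OF \<gamma> a] ball_subset_Omega_disk[OF \<gamma>] z by blast
    have "1 - of_real q * z = ?d / ?c"
      using c by (simp add: q_def field_simps)
    then have "of_real k * z / (1 - of_real q * z) = - ((1 - (of_real a)\<^sup>2) * z / ?d)"
      using c by (simp add: k_def)
    also have "\<dots> + of_real a = (of_real a * ?d - (1 - (of_real a)\<^sup>2) * z) / ?d"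
      using d by (simp add: diff_divide_distrib)
    also have "of_real a * ?d - (1 - (of_real a)\<^sup>2) * z
        = of_real a * (?c - of_real \<gamma> * z) - z"
      by (simp add: algebra_simps power2_eq_square)
    finally show ?thesis
      by (simp add: extremal_def)
  qed
  finally show ?thesis .
qed

lemma extremal_op_in_ball:
  fixes \<gamma> a :: real
  assumes \<gamma>: "0 \<le> \<gamma>" "\<gamma> < 1" and a: "0 \<le> a" "a < 1"
  defines "f \<equiv> \<lambda>z. extremal \<gamma> a z *\<^sub>C (id_op :: 'h::complex_hilbert bounded_op)"
    and "A \<equiv> \<lambda>n. of_real (extremal_coeff \<gamma> a n) *\<^sub>C (id_op :: 'h bounded_op)"
  shows "f \<in> H_inf (Omega_disk \<gamma>)" "H_inf_norm (Omega_disk \<gamma>) f \<le> 1" "has_expansion f A"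
    and "A 0 = of_real a *\<^sub>C id_op"
proof -
  have le: "norm (f z) \<le> 1" if "z \<in> Omega_disk \<gamma>" for z
    unfolding f_def norm_scaleC
    using extremal_bounds(2)[OF \<gamma> a that] norm_id_op_le by (intro mult_le_one) auto
  have "analytic_fun (Omega_disk \<gamma>) f"
    unfolding f_def extremal_def using extremal_bounds(1)[OF \<gamma> a]
    by (intro analytic_fun_scaleC holomorphic_intros) auto
  then show "f \<in> H_inf (Omega_disk \<gamma>)"
    using le by (auto simp: H_inf_def intro: boundedI)
  have "0 \<in> Omega_disk \<gamma>"
    using ball_subset_Omega_disk[OF \<gamma>] by auto
  then show "H_inf_norm (Omega_disk \<gamma>) f \<le> 1"
    unfolding H_inf_norm_def using le by (intro cSUP_least) auto
  show "has_expansion f A"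
    unfolding f_def A_def by (intro has_expansion_scaleC extremal_sums \<gamma> a)
  show "A 0 = of_real a *\<^sub>C id_op"
    by (simp add: A_def extremal_coeff_def)
qed

text \<open>Weighted arithmetic--geometric mean inequality for \<open>a\<^sup>p\<close> and \<open>1\<close> with weight \<open>1 / p\<close>.\<close>
lemma one_minus_powr_le:
  fixes a p :: real
  assumes "0 \<le> a" "1 \<le> p"
  shows "1 - a powr p \<le> p * (1 - a)"
proof (cases "a = 0")
  case False
  then have "(a powr p) powr (1 / p) * 1 powr (1 - 1 / p) \<le> 1 / p * a powr p + (1 - 1 / p) * 1"
    using assms by (intro Youngs_inequality_0) auto
  then have "p * a \<le> p * (1 / p * a powr p + (1 - 1 / p) * 1)"
    using False assms by (intro mult_left_mono) (auto simp: powr_powr)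
  then show ?thesis
    using assms by (simp add: algebra_simps)
qed (use assms in simp)

text \<open>By \<open>1 - a\<^sup>p \<le> p (1 - a)\<close> it suffices to violate the inequality after division by \<open>1 - a\<close>,
  that is, to have \<open>p \<phi>\<^sub>0 < (1 + a) / (1 + \<gamma>) \<Sum>\<^sub>n q\<^sup>n \<phi>\<^sub>n\<^sub>+\<^sub>1\<close> with \<open>q = (\<gamma> + a) / (1 + \<gamma>)\<close>. As \<open>a\<close> tends to
  \<open>1\<close>, so does \<open>q\<close>, and every partial sum of the right-hand side tends to its value at \<open>a = 1\<close>.\<close>
lemma extremal_coeff_violation:
  assumes \<gamma>: "0 \<le> \<gamma>" "\<gamma> < 1" and p: "1 \<le> p"
    and \<phi>: "\<phi> \<in> weights" and r: "0 \<le> r" "r < 1"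
    and less: "\<phi> 0 r < 2 / (p * (1 + \<gamma>)) * (\<Sum>n. \<phi> (Suc n) r)"
  obtains a where "0 \<le> a" "a < 1"
    "\<phi> 0 r < a powr p * \<phi> 0 r + (\<Sum>n. \<bar>extremal_coeff \<gamma> a (Suc n)\<bar> * \<phi> (Suc n) r)"
proof -
  note nonneg = weights_nonneg[OF \<phi> r]
  have summ: "summable (\<lambda>n. \<phi> (Suc n) r)"
    using weights_summable[OF \<phi> r] by (subst summable_Suc_iff)
  have "p * \<phi> 0 r < 2 / (1 + \<gamma>) * (\<Sum>n. \<phi> (Suc n) r)"
    using mult_strict_left_mono[OF less, of p] p by simp
  moreover have "(\<lambda>N. 2 / (1 + \<gamma>) * (\<Sum>n<N. \<phi> (Suc n) r)) \<longlonglongrightarrow> 2 / (1 + \<gamma>) * (\<Sum>n. \<phi> (Suc n) r)"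
    by (intro tendsto_intros summable_LIMSEQ summ)
  ultimately have "\<forall>\<^sub>F N in sequentially. p * \<phi> 0 r < 2 / (1 + \<gamma>) * (\<Sum>n<N. \<phi> (Suc n) r)"
    by (rule order_tendstoD(1)[rotated])
  \<comment> \<open>A partial sum already suffices, so that only finitely many terms pass to the limit in \<open>a\<close>.\<close>
  then obtain N where N: "p * \<phi> 0 r < 2 / (1 + \<gamma>) * (\<Sum>n<N. \<phi> (Suc n) r)"
    by (auto simp: eventually_sequentially)
  define h where "h = (\<lambda>a. (1 + a) / (1 + \<gamma>) * (\<Sum>n<N. ((\<gamma> + a) / (1 + \<gamma>)) ^ n * \<phi> (Suc n) r))"
  have "(h \<longlongrightarrow> (1 + 1) / (1 + \<gamma>) * (\<Sum>n<N. ((\<gamma> + 1) / (1 + \<gamma>)) ^ n * \<phi> (Suc n) r)) (at_left 1)"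
    unfolding h_def using \<gamma> by (intro tendsto_intros) auto
  also have "(\<gamma> + 1) / (1 + \<gamma>) = 1"
    using \<gamma> by simp
  finally have "(h \<longlongrightarrow> 2 / (1 + \<gamma>) * (\<Sum>n<N. \<phi> (Suc n) r)) (at_left 1)"
    by simp
  with N have "\<forall>\<^sub>F a in at_left 1. p * \<phi> 0 r < h a"
    by (intro order_tendstoD(1))
  moreover have "\<forall>\<^sub>F a in at_left 1. a \<in> {0<..<1::real}"
    by (rule eventually_at_left_real) simp
  ultimately have "\<forall>\<^sub>F a in at_left 1. p * \<phi> 0 r < h a \<and> a \<in> {0<..<1}"
    by (rule eventually_conj)
  then obtain a where a: "p * \<phi> 0 r < h a" "0 < a" "a < 1"
    using eventually_happens'[OF trivial_limit_at_left_real] by auto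
  define q where "q = (\<gamma> + a) / (1 + \<gamma>)"
  define k where "k = (1 - a\<^sup>2) / (1 + \<gamma>)"
  have q: "0 \<le> q" "q < 1"
    using \<gamma> a by (simp_all add: q_def)
  have k: "0 \<le> k"
    using \<gamma> a by (simp add: k_def power_le_one)
  have coeff: "\<bar>extremal_coeff \<gamma> a (Suc n)\<bar> = k * q ^ n" for n
  proof -
    have "extremal_coeff \<gamma> a (Suc n) = - (k * q ^ n)"
      by (simp only: extremal_coeff_def k_def q_def nat.case)
    then show ?thesis
      using k q by simp
  qed
  have summ': "summable (\<lambda>n. k * q ^ n * \<phi> (Suc n) r)"
  proof (rule summable_comparison_test'[OF summable_mult[OF summ, of k]])
    show "norm (k * q ^ n * \<phi> (Suc n) r) \<le> k * \<phi> (Suc n) r" for n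
      using k q nonneg[of "Suc n"]
      by (simp add: abs_mult power_le_one mult_left_le mult_right_mono)
  qed
  have "(1 - a powr p) * \<phi> 0 r \<le> p * (1 - a) * \<phi> 0 r"
    using one_minus_powr_le[of a p] a p nonneg[of 0] by (intro mult_right_mono) auto
  also have "\<dots> = (1 - a) * (p * \<phi> 0 r)"
    by simp
  also have "\<dots> < (1 - a) * h a"
    using a by (intro mult_strict_left_mono) auto
  also have "\<dots> = (\<Sum>n<N. k * q ^ n * \<phi> (Suc n) r)"
    by (simp add: h_def k_def q_def sum_distrib_left power2_eq_square algebra_simps)
  also have "\<dots> \<le> (\<Sum>n. k * q ^ n * \<phi> (Suc n) r)"
    using k q nonneg by (intro sum_le_suminf summ') auto
  finally have "\<phi> 0 r < a powr p * \<phi> 0 r + (\<Sum>n. \<bar>extremal_coeff \<gamma> a (Suc n)\<bar> * \<phi> (Suc n) r)"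
    by (simp add: coeff algebra_simps)
  with a show thesis
    by (intro that[of a]) auto
qed

section \<open>Bohr radii\<close>

text \<open>The sum of the coefficient series has to be non-negative for \<open>powr 1\<close> to be the identity, and
  this needs its convergence.\<close>
lemma bohr_set_iff:
  fixes f :: "complex \<Rightarrow> 'h::complex_hilbert bounded_op"
  assumes \<gamma>: "0 \<le> \<gamma>" "\<gamma> < 1" and \<phi>: "\<phi> \<in> weights"
    and f: "f \<in> H_inf (Omega_disk \<gamma>)" "H_inf_norm (Omega_disk \<gamma>) f \<le> 1"
    and A: "has_expansion f A" and A0: "A 0 = \<alpha> *\<^sub>C id_op" and \<alpha>: "cmod \<alpha> \<le> 1"
  shows "r \<in> bohr_set p 1 \<phi> f \<longleftrightarrow> 0 \<le> r \<and> r < 1 \<and>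
    norm (A 0) powr p * \<phi> 0 r + (\<Sum>n. norm (A (Suc n)) * \<phi> (Suc n) r) \<le> \<phi> 0 r"
proof -
  have "0 \<le> (\<Sum>n. norm (A (Suc n)) * \<phi> (Suc n) r)" if r: "0 \<le> r" "r < 1"
  proof (rule suminf_nonneg)
    show "summable (\<lambda>n. norm (A (Suc n)) * \<phi> (Suc n) r)"
      by (rule bohr_inequality_summable(1)[OF \<phi> r scalar_start_coeff_bound_Omega[OF \<gamma> f A A0 \<alpha>]]) simp
  qed (simp add: weights_nonneg[OF \<phi> r])
  then show ?thesis
    by (auto simp: bohr_set_def taylor_coeff_eq[OF A])
qed

text \<open>A violation at \<open>r\<close> caps the supremum for that \<open>f\<close> at \<open>r\<close>, whatever happens at larger radii.\<close>
lemma initial_bohr_radius_eqI: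
  fixes F :: "(complex \<Rightarrow> 'x::{complex_normed_vector,banach}) set"
  assumes R: "0 \<le> R" "R < 1"
    and below: "\<And>f. f \<in> F \<Longrightarrow> {0..R} \<subseteq> bohr_set p q \<phi> f"
    and above: "\<And>R'. R < R' \<Longrightarrow> R' < 1 \<Longrightarrow> \<exists>f\<in>F. \<exists>r\<ge>0. r \<le> R' \<and> r \<notin> bohr_set p q \<phi> f"
  shows "initial_bohr_radius p q \<phi> F = R"
proof -
  define I where "I = (\<lambda>f::complex \<Rightarrow> 'x. {r\<in>{0..<1}. {0..r} \<subseteq> bohr_set p q \<phi> f})"
  have F: "F \<noteq> {}"
    using above[of "(R + 1) / 2"] R by auto
  have RI: "R \<in> I f" if "f \<in> F" for f
    using below[OF that] R by (simp add: I_def)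
  have R_le: "R \<le> Sup (I f)" if "f \<in> F" for f
    by (intro cSup_upper RI[OF that]) (auto simp: I_def intro: bdd_aboveI[of _ 1])
  have "R \<le> (INF f\<in>F. Sup (I f))"
    using F R_le by (intro cINF_greatest)
  moreover have "(INF f\<in>F. Sup (I f)) \<le> R"
  proof (rule dense_ge_bounded[OF \<open>R < 1\<close>])
    fix R' assume R': "R < R'" "R' < 1"
    obtain f r where f: "f \<in> F" and r: "0 \<le> r" "r \<le> R'" "r \<notin> bohr_set p q \<phi> f"
      using above[OF R'] by blast
    have "Sup (I f) \<le> R'"
    proof (rule cSup_least)
      fix s assume "s \<in> I f"
      then have "\<not> r \<le> s"
        using r by (auto simp: I_def)
      then show "s \<le> R'"
        using r by simp
    qed (use RI[OF f] in auto)
    moreover have "bdd_below ((\<lambda>f. Sup (I f)) ` F)"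
      using R_le by (intro bdd_belowI2[of _ R])
    ultimately show "(INF f\<in>F. Sup (I f)) \<le> R'"
      using f by (intro cINF_lower2)
  qed
  ultimately show ?thesis
    by (simp add: initial_bohr_radius_def I_def)
qed

lemma bohr_radius_eq_initial:
  assumes "\<And>f r. f \<in> F \<Longrightarrow> r \<in> bohr_set p q \<phi> f \<Longrightarrow> {0..r} \<subseteq> bohr_set p q \<phi> f"
  shows "bohr_radius p q \<phi> F = initial_bohr_radius p q \<phi> F"
proof -
  have "{r\<in>{0..<1}. {0..r} \<subseteq> bohr_set p q \<phi> f} = bohr_set p q \<phi> f" if "f \<in> F" for f
    using assms[OF that] by (auto simp: bohr_set_def)
  then show ?thesis
    by (simp add: bohr_radius_def initial_bohr_radius_def)
qed

theorem theorem1p4: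
  fixes \<gamma> p R :: real and \<phi> :: "nat \<Rightarrow> real \<Rightarrow> real"
  assumes gamma: "0 \<le> \<gamma>" "\<gamma> < 1"
    and p: "1 \<le> p" "p \<le> 2"
    and phi: "\<phi> \<in> weights"
    and R_range: "0 < R" "R < 1"
    and R_root: "\<phi> 0 R = 2 / (p * (1 + \<gamma>)) * (\<Sum>n. \<phi> (Suc n) R)"
    and R_smallest: "\<And>x. 0 < x \<Longrightarrow> x < 1 \<Longrightarrow>
      \<phi> 0 x = 2 / (p * (1 + \<gamma>)) * (\<Sum>n. \<phi> (Suc n) x) \<Longrightarrow> R \<le> x"
    and below_R: "\<And>r. 0 \<le> r \<Longrightarrow> r < R \<Longrightarrow>
      \<phi> 0 r > 2 / (p * (1 + \<gamma>)) * (\<Sum>n. \<phi> (Suc n) r)"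
  shows "(\<forall>(f :: complex \<Rightarrow> 'h::complex_hilbert bounded_op) A \<alpha>.
      f \<in> H_inf (Omega_disk \<gamma>) \<and> H_inf_norm (Omega_disk \<gamma>) f \<le> 1 \<and>
      has_expansion f A \<and> A 0 = \<alpha> *\<^sub>C id_op \<and> cmod \<alpha> < 1 \<longrightarrow>
      (\<forall>r. 0 \<le> r \<and> r \<le> R \<longrightarrow>
        norm (A 0) powr p * \<phi> 0 r + (\<Sum>n. norm (A (Suc n)) * \<phi> (Suc n) r) \<le> \<phi> 0 r)) \<and>
    ((\<exists>x::'h. x \<noteq> 0) \<and>
      (\<exists>\<epsilon>>0. R + \<epsilon> \<le> 1 \<and>
        (\<forall>x. R < x \<and> x < R + \<epsilon> \<longrightarrow> \<phi> 0 x < 2 / (p * (1 + \<gamma>)) * (\<Sum>n. \<phi> (Suc n) x))) \<longrightarrow>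
      (\<forall>R'. R < R' \<and> R' < 1 \<longrightarrow>
        (\<exists>(f :: complex \<Rightarrow> 'h bounded_op) A \<alpha> r.
          f \<in> H_inf (Omega_disk \<gamma>) \<and> H_inf_norm (Omega_disk \<gamma>) f \<le> 1 \<and>
          has_expansion f A \<and> A 0 = \<alpha> *\<^sub>C id_op \<and> cmod \<alpha> < 1 \<and> 0 \<le> r \<and> r \<le> R' \<and>
          \<not> norm (A 0) powr p * \<phi> 0 r + (\<Sum>n. norm (A (Suc n)) * \<phi> (Suc n) r) \<le> \<phi> 0 r)) \<and>
      ((\<forall>r. 0 \<le> r \<and> r < 1 \<longrightarrow> \<phi> 0 r \<le> 1) \<longrightarrow>
        initial_bohr_radius p 1 \<phi>
          (scalar_start_ball (Omega_disk \<gamma>) :: (complex \<Rightarrow> 'h bounded_op) set) = R \<and>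
        ((\<forall>f \<in> (scalar_start_ball (Omega_disk \<gamma>) :: (complex \<Rightarrow> 'h bounded_op) set).
            \<forall>r \<in> bohr_set p 1 \<phi> f. {0..r} \<subseteq> bohr_set p 1 \<phi> f) \<longrightarrow>
          bohr_radius p 1 \<phi>
            (scalar_start_ball (Omega_disk \<gamma>) :: (complex \<Rightarrow> 'h bounded_op) set) = R)))"
proof -
  let ?F = "scalar_start_ball (Omega_disk \<gamma>) :: (complex \<Rightarrow> 'h bounded_op) set"
  let ?viol = "\<lambda>(f :: complex \<Rightarrow> 'h bounded_op) A \<alpha> r R'.
          f \<in> H_inf (Omega_disk \<gamma>) \<and> H_inf_norm (Omega_disk \<gamma>) f \<le> 1 \<and>
          has_expansion f A \<and> A 0 = \<alpha> *\<^sub>C id_op \<and> cmod \<alpha> < 1 \<and> 0 \<le> r \<and> r \<le> R' \<and>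
          \<not> norm (A 0) powr p * \<phi> 0 r + (\<Sum>n. norm (A (Suc n)) * \<phi> (Suc n) r) \<le> \<phi> 0 r"
  have ineq: "norm (A 0) powr p * \<phi> 0 r + (\<Sum>n. norm (A (Suc n)) * \<phi> (Suc n) r) \<le> \<phi> 0 r"
    if "f \<in> H_inf (Omega_disk \<gamma>)" "H_inf_norm (Omega_disk \<gamma>) f \<le> 1"
      "has_expansion f A" "A 0 = \<alpha> *\<^sub>C id_op" "cmod \<alpha> < 1" "0 \<le> r" "r \<le> R"
    for f :: "complex \<Rightarrow> 'h bounded_op" and A \<alpha> r
  proof (rule bohr_inequality[OF gamma _ p(2) phi that(6) _ _ that(1-4)])
    show "2 / (p * (1 + \<gamma>)) * (\<Sum>n. \<phi> (Suc n) r) \<le> \<phi> 0 r"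
      using below_R[OF that(6)] R_root that(7) by (cases "r = R") auto
  qed (use that p R_range in auto)
  have viol: "\<exists>f A \<alpha> r. ?viol f A \<alpha> r R'"
    if "\<exists>x::'h. x \<noteq> 0" "0 < \<epsilon>" "R + \<epsilon> \<le> 1"
      and above: "\<And>x. R < x \<Longrightarrow> x < R + \<epsilon> \<Longrightarrow> \<phi> 0 x < 2 / (p * (1 + \<gamma>)) * (\<Sum>n. \<phi> (Suc n) x)"
      and R': "R < R'" "R' < 1" for \<epsilon> R'
  proof -
    obtain r where r: "R < r" "r < min R' (R + \<epsilon>)"
      using dense[of R "min R' (R + \<epsilon>)"] R' \<open>0 < \<epsilon>\<close> by auto
    then obtain a where a: "0 \<le> a" "a < 1"
        "\<phi> 0 r < a powr p * \<phi> 0 r + (\<Sum>n. \<bar>extremal_coeff \<gamma> a (Suc n)\<bar> * \<phi> (Suc n) r)"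
      using extremal_coeff_violation[OF gamma p(1) phi, of r] above[of r] R_range R' by auto
    define A where "A = (\<lambda>n. of_real (extremal_coeff \<gamma> a n) *\<^sub>C (id_op :: 'h bounded_op))"
    have "norm (A n) = \<bar>extremal_coeff \<gamma> a n\<bar>" for n
      using that(1) by (auto simp: A_def norm_scaleC norm_id_op)
    moreover from this have "norm (A 0) = a"
      using a by (simp add: extremal_coeff_def)
    ultimately have "?viol (\<lambda>z. extremal \<gamma> a z *\<^sub>C id_op) A (of_real a) r R'"
      using extremal_op_in_ball[OF gamma a(1,2), where 'h = 'h] a r R_range by (simp add: A_def)
    then show ?thesis
      by blast
  qed
  have radius: "initial_bohr_radius p 1 \<phi> ?F = R"
    if viol: "\<And>R'. R < R' \<Longrightarrow> R' < 1 \<Longrightarrow> \<exists>f A \<alpha> r. ?viol f A \<alpha> r R'"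
  proof (rule initial_bohr_radius_eqI)
    fix f :: "complex \<Rightarrow> 'h bounded_op" assume "f \<in> ?F"
    then obtain A \<alpha> where f: "f \<in> H_inf (Omega_disk \<gamma>)" "H_inf_norm (Omega_disk \<gamma>) f \<le> 1"
        "has_expansion f A" "A 0 = \<alpha> *\<^sub>C id_op" "cmod \<alpha> < 1"
      by (auto simp: scalar_start_ball_def)
    show "{0..R} \<subseteq> bohr_set p 1 \<phi> f"
      using ineq[OF f] bohr_set_iff[OF gamma phi f(1-4), of _ p] f(5) R_range by auto
  next
    fix R' assume "R < R'" "R' < 1"
    from viol[OF this] obtain f :: "complex \<Rightarrow> 'h bounded_op" and A \<alpha> r where
      f: "f \<in> H_inf (Omega_disk \<gamma>)" "H_inf_norm (Omega_disk \<gamma>) f \<le> 1"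
        "has_expansion f A" "A 0 = \<alpha> *\<^sub>C id_op" "cmod \<alpha> < 1"
      and r: "0 \<le> r" "r \<le> R'"
        "\<not> norm (A 0) powr p * \<phi> 0 r + (\<Sum>n. norm (A (Suc n)) * \<phi> (Suc n) r) \<le> \<phi> 0 r"
      by blast
    have "f \<in> ?F"
      using f by (auto simp: scalar_start_ball_def)
    moreover have "r \<notin> bohr_set p 1 \<phi> f"
      using r f(5) bohr_set_iff[OF gamma phi f(1-4), of r p] by simp
    ultimately show "\<exists>f\<in>?F. \<exists>r\<ge>0. r \<le> R' \<and> r \<notin> bohr_set p 1 \<phi> f"
      using r by blast
  qed (use R_range in auto)
  have full_radius: "bohr_radius p 1 \<phi> ?F = initial_bohr_radius p 1 \<phi> ?F"
    if "\<forall>f \<in> ?F. \<forall>r \<in> bohr_set p 1 \<phi> f. {0..r} \<subseteq> bohr_set p 1 \<phi> f"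
    using that by (intro bohr_radius_eq_initial) blast
  show ?thesis
  proof (rule conjI[OF _ impI])
    show "\<forall>(f :: complex \<Rightarrow> 'h bounded_op) A \<alpha>.
      f \<in> H_inf (Omega_disk \<gamma>) \<and> H_inf_norm (Omega_disk \<gamma>) f \<le> 1 \<and>
      has_expansion f A \<and> A 0 = \<alpha> *\<^sub>C id_op \<and> cmod \<alpha> < 1 \<longrightarrow>
      (\<forall>r. 0 \<le> r \<and> r \<le> R \<longrightarrow>
        norm (A 0) powr p * \<phi> 0 r + (\<Sum>n. norm (A (Suc n)) * \<phi> (Suc n) r) \<le> \<phi> 0 r)"
      using ineq by blast
  next
    assume "(\<exists>x::'h. x \<noteq> 0) \<and>
      (\<exists>\<epsilon>>0. R + \<epsilon> \<le> 1 \<and>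
        (\<forall>x. R < x \<and> x < R + \<epsilon> \<longrightarrow> \<phi> 0 x < 2 / (p * (1 + \<gamma>)) * (\<Sum>n. \<phi> (Suc n) x)))"
    then obtain \<epsilon> where "\<exists>x::'h. x \<noteq> 0" "0 < \<epsilon>" "R + \<epsilon> \<le> 1"
        "\<And>x. R < x \<Longrightarrow> x < R + \<epsilon> \<Longrightarrow> \<phi> 0 x < 2 / (p * (1 + \<gamma>)) * (\<Sum>n. \<phi> (Suc n) x)"
      by blast
    from viol[OF this] have V: "\<exists>f A \<alpha> r. ?viol f A \<alpha> r R'" if "R < R'" "R' < 1" for R'
      using that by blast
    show "(\<forall>R'. R < R' \<and> R' < 1 \<longrightarrow> (\<exists>f A \<alpha> r. ?viol f A \<alpha> r R')) \<and>
      ((\<forall>r. 0 \<le> r \<and> r < 1 \<longrightarrow> \<phi> 0 r \<le> 1) \<longrightarrow>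
        initial_bohr_radius p 1 \<phi> ?F = R \<and>
        ((\<forall>f \<in> ?F. \<forall>r \<in> bohr_set p 1 \<phi> f. {0..r} \<subseteq> bohr_set p 1 \<phi> f) \<longrightarrow>
          bohr_radius p 1 \<phi> ?F = R))"
      using V radius[OF V] full_radius by (intro conjI impI allI) auto
  qed
qed

end
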